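(* Let $G$ be a 2-connected undirected graph with $n=|V(G)|$ vertices, and let $H$ be a subgraph of $G$. Then $H$ is a locked subgraph of $G$ if and only if $H$ is an induced and 2-connected subgraph of $G$ satisfying all of the following conditions: (i) $3\leq n_H\leq n-1$; (ii) $m_{\overline{H}}\geq n_{\overline{H}}$ or $|V(H)\cap V(\overline{H})|\geq 3$; (iii) $G(V(G)\backslash V(H))$ is a connected subgraph.
   Context: Graphs are finite and undirected, and parallel edges are allowed. For a subgraph $H$ of $G$, $V(H)$ and $E(H)$ are its vertex and edge sets, $n_H=|V(H)|$ and $m_H=|E(H)|$. For $U\subseteq V(G)$, $G(U)$ is the subgraph of $G$ induced by $U$. For $F\subseteq E(G)$, $V(F)$ is the set of vertices incident to at least one edge of $F$. The complementary subgraph of $H$ in $G$ is $\overline{H}=(V(E(G)\backslash E(H)),\,E(G)\backslash E(H))$, so $m_{\overline H}=|E(G)\backslash E(H)|$ and $n_{\overline H}=|V(E(G)\backslash E(H))|$. A matroid $M$ on $E$ with rank function $r$ is disconnected if there is a proper nonempty subset $X\subset E$ with $r(E)=r(X)+r(E\backslash X)$; otherwise it is 2-connected. $M^*$ denotes the dual matroid and $r^*$ its rank function, $r^*(X)=|X|-r(E)+r(E\backslash X)$. $M|X$ denotes the restriction of $M$ to $X$. For a 2-connected matroid $M$ on $E$, a subset $L\subset E$ is a locked subset of $M$ if $M|L$ and $M^*|(E\backslash L)$ are both 2-connected and $\min\{r(L),r^*(E\backslash L)\}\geq 2$. $M(G)$ is the graphical matroid of the connected graph $G$: its ground set is $E(G)$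 and its bases are the spanning trees of $G$. A graph is 2-connected in the sense that corresponds to 2-connectedness of its graphical matroid (a graphical matroid is 2-connected if and only if its graph is 2-connected). A locked subgraph of $G$ is a subgraph $H$ for which $E(H)$ is a locked subset of $M(G)$.
   Formalization: A locked subgraph H is additionally required to have V(H)=V(E(H)), i.e. no isolated vertices; without this the "only if" fails, e.g. G=K4 and H a triangle plus the fourth vertex isolated: E(H) is locked but H is not 2-connected. *)

theory Defs
  imports Main
begin

section \<open>Multigraphs\<close>

text \<open>An undirected multigraph: edges are abstract objects, and \<open>ends\<close> gives the one or two
  end vertices of an edge, so that parallel edges are distinct edges with the same ends.\<close>

record ('v, 'e) multigraph =
  verts :: "'v set"
  edges :: "'e set"
  ends :: "'e \<Rightarrow> 'v set"

text \<open>Loops (edges with a single end) are not excluded here.\<close>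

definition finite_multigraph :: "('v, 'e) multigraph \<Rightarrow> bool" where
  "finite_multigraph G \<longleftrightarrow> finite (verts G) \<and> finite (edges G) \<and>
     (\<forall>e\<in>edges G. ends G e \<subseteq> verts G \<and> card (ends G e) \<in> {1, 2})"

text \<open>Since the incidence function of a subgraph is that of the ambient graph, a subgraph is
  determined by its vertex set and its edge set.\<close>

definition subgraph :: "('v, 'e) multigraph \<Rightarrow> ('v, 'e) multigraph \<Rightarrow> bool" where
  "subgraph H G \<longleftrightarrow> verts H \<subseteq> verts G \<and> edges H \<subseteq> edges G \<and> ends H = ends G \<and>
     finite_multigraph H"

definition incident_verts :: "('v, 'e) multigraph \<Rightarrow> 'e set \<Rightarrow> 'v set" where
  "incident_verts G F = (\<Union>e\<in>F. ends G e)"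

definition induced_subgraph :: "('v, 'e) multigraph \<Rightarrow> 'v set \<Rightarrow> ('v, 'e) multigraph" where
  "induced_subgraph G U = \<lparr>verts = U, edges = {e \<in> edges G. ends G e \<subseteq> U}, ends = ends G\<rparr>"

definition complementary_subgraph ::
    "('v, 'e) multigraph \<Rightarrow> ('v, 'e) multigraph \<Rightarrow> ('v, 'e) multigraph" where
  "complementary_subgraph G H =
     \<lparr>verts = incident_verts G (edges G - edges H), edges = edges G - edges H, ends = ends G\<rparr>"

text \<open>A walk is given by its start vertex and the list of its steps; a step consists of the edge
  that is traversed and the vertex that is reached.\<close>

fun walk :: "('v, 'e) multigraph \<Rightarrow> 'v \<Rightarrow> ('e \<times> 'v) list \<Rightarrow> 'v \<Rightarrow> bool" where
  "walk G u [] v \<longleftrightarrow> u \<in> verts G \<and> u = v"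
| "walk G u ((e, w) # p) v \<longleftrightarrow> u \<in> verts G \<and> e \<in> edges G \<and> ends G e = {u, w} \<and> walk G w p v"

definition connected_graph :: "('v, 'e) multigraph \<Rightarrow> bool" where
  "connected_graph G \<longleftrightarrow> verts G \<noteq> {} \<and> (\<forall>u\<in>verts G. \<forall>v\<in>verts G. \<exists>p. walk G u p v)"

text \<open>A loop is a cycle of length 1 and two parallel edges form a cycle of length 2; distinctness
  of the edges keeps a single edge traversed back and forth from counting as a cycle.\<close>

definition cycle :: "('v, 'e) multigraph \<Rightarrow> 'v \<Rightarrow> ('e \<times> 'v) list \<Rightarrow> bool" where
  "cycle G u p \<longleftrightarrow> p \<noteq> [] \<and> walk G u p u \<and> distinct (map fst p) \<and> distinct (map snd p)"

definition tree :: "('v, 'e) multigraph \<Rightarrow> bool" where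
  "tree G \<longleftrightarrow> connected_graph G \<and> \<not> (\<exists>u p. cycle G u p)"

definition spanning_tree :: "('v, 'e) multigraph \<Rightarrow> 'e set \<Rightarrow> bool" where
  "spanning_tree G T \<longleftrightarrow> T \<subseteq> edges G \<and> tree \<lparr>verts = verts G, edges = T, ends = ends G\<rparr>"


section \<open>Matroids\<close>

text \<open>A matroid is represented by its ground set and its rank function, of which only the values
  on subsets of the ground set are meaningful.  The matroid axioms are not part of the type.\<close>

record 'e matroid =
  ground :: "'e set"
  rk :: "'e set \<Rightarrow> nat"

text \<open>The natural number subtraction does not truncate, as
  \<open>r(E) \<le> r(X) + r(E - X) \<le> |X| + r(E - X)\<close> in a matroid.\<close>

definition dual_matroid :: "'e matroid \<Rightarrow> 'e matroid" where
  "dual_matroid M =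
     \<lparr>ground = ground M, rk = (\<lambda>X. card X + rk M (ground M - X) - rk M (ground M))\<rparr>"

definition restrict_matroid :: "'e matroid \<Rightarrow> 'e set \<Rightarrow> 'e matroid" where
  "restrict_matroid M X = \<lparr>ground = X, rk = rk M\<rparr>"

definition disconnected_matroid :: "'e matroid \<Rightarrow> bool" where
  "disconnected_matroid M \<longleftrightarrow>
     (\<exists>X. X \<noteq> {} \<and> X \<subset> ground M \<and> rk M (ground M) = rk M X + rk M (ground M - X))"

definition two_connected_matroid :: "'e matroid \<Rightarrow> bool" where
  "two_connected_matroid M \<longleftrightarrow> \<not> disconnected_matroid M"

definition locked_subset :: "'e matroid \<Rightarrow> 'e set \<Rightarrow> bool" where
  "locked_subset M L \<longleftrightarrow> two_connected_matroid M \<and> L \<subseteq> ground M \<and>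
     two_connected_matroid (restrict_matroid M L) \<and>
     two_connected_matroid (restrict_matroid (dual_matroid M) (ground M - L)) \<and>
     min (rk M L) (rk (dual_matroid M) (ground M - L)) \<ge> 2"


section \<open>Graphical matroids and locked subgraphs\<close>

text \<open>The matroid whose bases are the spanning trees of a connected graph: the rank of a set is the
  largest size of its intersection with a basis.\<close>

definition graphic_matroid :: "('v, 'e) multigraph \<Rightarrow> 'e matroid" where
  "graphic_matroid G =
     \<lparr>ground = edges G, rk = (\<lambda>X. Max {card (T \<inter> X) |T. spanning_tree G T})\<rparr>"

text \<open>2-connectedness of a graph is taken in the matroidal sense.  The graph is required to be
  connected because only then is its graphical matroid given by its spanning trees.\<close>

definition two_connected_graph :: "('v, 'e) multigraph \<Rightarrow> bool" where
  "two_connected_graph G \<longleftrightarrow> connected_graph G \<and> two_connected_matroid (graphic_matroid G)"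

text \<open>A locked subgraph is the subgraph formed by a locked set of edges and the vertices incident
  to them.  Without the condition on the vertices, one could add isolated vertices to a locked
  subgraph, which its edge set does not see, and destroy its connectedness.\<close>

definition locked_subgraph :: "('v, 'e) multigraph \<Rightarrow> ('v, 'e) multigraph \<Rightarrow> bool" where
  "locked_subgraph G H \<longleftrightarrow> subgraph H G \<and> verts H = incident_verts G (edges H) \<and>
     locked_subset (graphic_matroid G) (edges H)"

end

theory Submission imports Defs begin

text \<open>
  The rank of an edge set is the number of its vertices minus the number of its components, and it
  is the matroid rank for every connected graph containing the edges. Writing \<open>L\<close> for the edges of
  \<open>H\<close>, the restriction of the dual matroid to the edges outside \<open>L\<close> is the dual of the contraction
  by \<open>L\<close>, so the two are 2-connected together, and this contraction is the graphical matroid of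
  the graph \<open>G/H\<close> in which the vertices of \<open>H\<close> are identified to one vertex \<open>c\<close>. A connected
  loopless graph has a 2-connected matroid iff no vertex separates it. For \<open>G/H\<close>, absence of loops
  means that \<open>H\<close> is induced; deleting \<open>c\<close> leaves the subgraph of condition (iii); and no other
  vertex separates \<open>G/H\<close> because none separates \<open>G\<close>. The dual rank of the edges outside \<open>L\<close> is their
  number minus the number of vertices outside \<open>H\<close>, and given the other conditions, (ii) says that
  it is at least 2: the vertices that \<open>H\<close> shares with its complement number at least 2, and each of
  them sends an edge to the connected subgraph of condition (iii).
\<close>

section \<open>Connectivity and rank of an edge set\<close>

definition conn :: "('e \<Rightarrow> 'v set) \<Rightarrow> 'e set \<Rightarrow> ('v \<times> 'v) set" where
  "conn f F = {(u, v). \<exists>e\<in>F. f e = {u, v}}\<^sup>*"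

lemma conn_refl [simp]: "(u, u) \<in> conn f F"
  by (simp add: conn_def)

lemma conn_trans: "(u, v) \<in> conn f F \<Longrightarrow> (v, w) \<in> conn f F \<Longrightarrow> (u, w) \<in> conn f F"
  unfolding conn_def by (rule rtrancl_trans)

lemma conn_sym:
  assumes "(u, v) \<in> conn f F"
  shows "(v, u) \<in> conn f F"
proof -
  have "sym {(u, v). \<exists>e\<in>F. f e = {u, v}}"
    unfolding sym_def by (simp add: doubleton_eq_iff) (metis insert_commute)
  then have "sym (conn f F)"
    unfolding conn_def by (rule sym_rtrancl)
  then show ?thesis
    using assms by (rule symD)
qed

lemma conn_edge: "e \<in> F \<Longrightarrow> f e = {u, v} \<Longrightarrow> (u, v) \<in> conn f F"
  unfolding conn_def by (rule r_into_rtrancl) blast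

lemma conn_induct [consumes 1, case_names refl step]:
  assumes "(u, v) \<in> conn f F" and "P u"
    and "\<And>x y e. (u, x) \<in> conn f F \<Longrightarrow> P x \<Longrightarrow> e \<in> F \<Longrightarrow> f e = {x, y} \<Longrightarrow> P y"
  shows "P v"
  using assms(1)[unfolded conn_def]
proof (induction rule: rtrancl_induct)
  case (step x y)
  then obtain e where "e \<in> F" "f e = {x, y}"
    by blast
  with step show ?case
    using assms(3) unfolding conn_def by blast
qed (rule assms(2))

text \<open>Transports paths along a vertex map. It is used below with the identity, with a
  retraction onto one side of a cut vertex, and with the projection to a contraction.\<close>

lemma conn_hom:
  assumes "(u, v) \<in> conn f F"
    and "\<And>e x y. e \<in> F \<Longrightarrow> f e = {x, y} \<Longrightarrow> (h x, h y) \<in> conn g K"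
  shows "(h u, h v) \<in> conn g K"
  using assms(1) by (induction rule: conn_induct) (auto intro: conn_trans assms(2))

lemma conn_subset:
  assumes "\<And>e x y. e \<in> F \<Longrightarrow> f e = {x, y} \<Longrightarrow> (x, y) \<in> conn g K"
  shows "conn f F \<subseteq> conn g K"
  using conn_hom[where h = "\<lambda>x. x" and f = f and F = F and g = g and K = K] assms by auto

lemma conn_mono: "F \<subseteq> K \<Longrightarrow> conn f F \<subseteq> conn f K"
  by (rule conn_subset) (auto intro: conn_edge)

lemma conn_insert_cong:
  assumes "conn f F = conn f K"
  shows "conn f (insert e F) = conn f (insert e K)"
proof -
  have "conn f (insert e A) \<subseteq> conn f (insert e B)" if AB: "conn f A = conn f B" for A B
  proof (rule conn_subset)
    fix e' x y assume e': "e' \<in> insert e A" "f e' = {x, y}"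
    show "(x, y) \<in> conn f (insert e B)"
    proof (cases "e' = e")
      case True
      then show ?thesis using e' by (auto intro: conn_edge)
    next
      case False
      then have "(x, y) \<in> conn f B"
        using e' AB conn_edge[of e' A f x y] by auto
      then show ?thesis
        using conn_mono[of B "insert e B" f] by auto
    qed
  qed
  from this[OF assms] this[OF assms[symmetric]] show ?thesis
    by auto
qed

lemma conn_insert_redundant:
  assumes "f e = {u, v}" "(u, v) \<in> conn f F"
  shows "conn f (insert e F) = conn f F"
proof
  show "conn f (insert e F) \<subseteq> conn f F"
  proof (rule conn_subset)
    fix e' x y assume e': "e' \<in> insert e F" "f e' = {x, y}"
    show "(x, y) \<in> conn f F"
      using e' assms conn_sym[OF assms(2)] by (cases "e' = e") (auto simp: doubleton_eq_iff intro: conn_edge)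
  qed
qed (auto intro: conn_mono[THEN subsetD])

text \<open>The ends are chosen independently on the two sides: if both choices give the same end of
  \<open>e\<close>, then \<open>x\<close> and \<open>y\<close> are already joined in
  \<open>F\<close>, so no case distinction on the direction of travel along \<open>e\<close>
  arises.\<close>

lemma conn_insert_iff:
  assumes uv: "f e = {u, v}"
  shows "(x, y) \<in> conn f (insert e F) \<longleftrightarrow> (x, y) \<in> conn f F \<or>
    ((x, u) \<in> conn f F \<or> (x, v) \<in> conn f F) \<and> ((u, y) \<in> conn f F \<or> (v, y) \<in> conn f F)"
    (is "_ \<longleftrightarrow> ?R x y")
proof
  assume "(x, y) \<in> conn f (insert e F)"
  then show "?R x y"
  proof (induction rule: conn_induct)
    case refl
    show ?case
      by (rule disjI1, rule conn_refl)
  next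
    case (step y z e')
    note IH = step.IH and e' = step.hyps(2,3)
    show ?case
    proof (cases "e' = e")
      case True
      then have "y = u \<and> z = v \<or> y = v \<and> z = u"
        using e'(2) uv True by (metis doubleton_eq_iff)
      then show ?thesis
        using IH conn_refl[of v f F] conn_refl[of u f F] by blast
    next
      case False
      then have "(y, z) \<in> conn f F"
        using e' conn_edge[of e' F f y z] by blast
      then have *: "(w, z) \<in> conn f F" if "(w, y) \<in> conn f F" for w
        using that conn_trans by fast
      show ?thesis
        using IH *[of x] *[of u] *[of v] by argo
    qed
  qed
next
  let ?C = "conn f (insert e F)"
  have uvC: "(u, v) \<in> ?C"
    using uv by (rule conn_edge[OF insertI1])
  have sub: "conn f F \<subseteq> ?C"
    by (rule conn_mono) auto
  assume "?R x y"
  then consider "(x, y) \<in> ?C" | "(x, u) \<in> ?C \<or> (x, v) \<in> ?C" "(u, y) \<in> ?C \<or> (v, y) \<in> ?C"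
    using sub by blast
  then show "(x, y) \<in> ?C"
  proof cases
    case 2
    then have "(x, u) \<in> ?C" "(u, y) \<in> ?C"
      using conn_trans[OF _ conn_sym[OF uvC]] conn_trans[OF uvC] by blast+
    then show ?thesis
      by (rule conn_trans)
  qed
qed

section \<open>Components and rank\<close>

definition ncomp :: "('e \<Rightarrow> 'v set) \<Rightarrow> 'v set \<Rightarrow> 'e set \<Rightarrow> nat" where
  "ncomp f V F = card ((\<lambda>v. conn f F `` {v}) ` V)"

text \<open>The rank in the cycle matroid. Only vertices on edges of \<open>F\<close> are counted,
  so the value does not depend on an ambient graph. For finite \<open>F\<close> the subtraction does
  not truncate, since there are at most as many classes as vertices.\<close>

definition erank :: "('e \<Rightarrow> 'v set) \<Rightarrow> 'e set \<Rightarrow> nat" where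
  "erank f F = card (\<Union>(f ` F)) - ncomp f (\<Union>(f ` F)) F"

text \<open>The case \<open>u = v\<close> is allowed, so loops are covered; contraction creates
  them.\<close>

definition finite_edges :: "('e \<Rightarrow> 'v set) \<Rightarrow> 'e set \<Rightarrow> bool" where
  "finite_edges f F \<longleftrightarrow> finite F \<and> (\<forall>e\<in>F. \<exists>u v. f e = {u, v})"

lemma finite_edgesD: "finite_edges f F \<Longrightarrow> finite F"
  by (simp add: finite_edges_def)

lemma finite_edgesE:
  assumes "finite_edges f F" "e \<in> F"
  obtains u v where "f e = {u, v}"
  using assms unfolding finite_edges_def by blast

lemma finite_edges_subset: "finite_edges f F \<Longrightarrow> K \<subseteq> F \<Longrightarrow> finite_edges f K"
  unfolding finite_edges_def by (meson finite_subset subsetD)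

lemma finite_edges_Un: "finite_edges f F \<Longrightarrow> finite_edges f K \<Longrightarrow> finite_edges f (F \<union> K)"
  unfolding finite_edges_def by auto

lemma finite_edges_empty [simp]: "finite_edges f {}"
  by (simp add: finite_edges_def)

lemma finite_Union_ends: "finite_edges f F \<Longrightarrow> finite (\<Union>(f ` F))"
  unfolding finite_edges_def by auto

lemma class_eq_iff: "conn f F `` {u} = conn f F `` {v} \<longleftrightarrow> (u, v) \<in> conn f F"
proof
  assume eq: "conn f F `` {u} = conn f F `` {v}"
  have "v \<in> conn f F `` {v}"
    by simp
  then show "(u, v) \<in> conn f F"
    unfolding eq[symmetric] by simp
next
  assume uv: "(u, v) \<in> conn f F"
  then show "conn f F `` {u} = conn f F `` {v}"
    using conn_trans[OF uv] conn_trans[OF conn_sym[OF uv]] by auto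
qed

lemma conn_closed:
  assumes "(u, v) \<in> conn f F" "u \<in> S"
    and "\<And>e. e \<in> F \<Longrightarrow> f e \<inter> S \<noteq> {} \<Longrightarrow> f e \<subseteq> S"
  shows "v \<in> S"
  using assms(1)
proof (induction rule: conn_induct)
  case (step x y e)
  then show ?case
    using assms(3)[of e] by blast
qed (rule assms(2))

lemma conn_isolated:
  assumes "(u, v) \<in> conn f F" "u \<notin> \<Union>(f ` F)"
  shows "v = u"
  using conn_closed[OF assms(1), of "{u}"] assms(2) by auto

text \<open>Each vertex of \<open>V\<close> on no edge is a class by itself, so it adds one to both
  the vertex count and the class count. This allows ranks of different edge sets to be compared over
  one common vertex set.\<close>

lemma erank_ncomp:
  assumes "finite V" "\<Union>(f ` F) \<subseteq> V"
  shows "erank f F + ncomp f V F = card V"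
proof -
  let ?U = "\<Union>(f ` F)" and ?c = "\<lambda>v. conn f F `` {v}"
  have fin: "finite ?U" "finite (V - ?U)"
    using assms finite_subset by auto
  have sing: "?c v = {v}" if "v \<notin> ?U" for v
    using conn_isolated[of v _ f F] that by auto
  have "?c ` V = ?c ` ?U \<union> ?c ` (V - ?U)"
    using assms(2) by blast
  moreover have "?c ` ?U \<inter> ?c ` (V - ?U) = {}"
  proof (rule ccontr)
    assume "?c ` ?U \<inter> ?c ` (V - ?U) \<noteq> {}"
    then obtain u v where "u \<in> ?U" "v \<notin> ?U" "?c u = ?c v"
      by blast
    then have "(v, u) \<in> conn f F"
      by (metis class_eq_iff)
    then show False
      using conn_isolated \<open>u \<in> ?U\<close> \<open>v \<notin> ?U\<close> by metis
  qed
  ultimately have "ncomp f V F = ncomp f ?U F + card (?c ` (V - ?U))"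
    unfolding ncomp_def using fin by (simp add: card_Un_disjoint)
  moreover have "card (?c ` (V - ?U)) = card (V - ?U)"
    by (rule card_image) (auto simp: inj_on_def sing)
  moreover have "card V = card ?U + card (V - ?U)"
    using assms by (metis fin(1) card_Diff_subset card_mono le_add_diff_inverse)
  moreover have "ncomp f ?U F \<le> card ?U"
    unfolding ncomp_def using fin by (simp add: card_image_le)
  ultimately show ?thesis
    unfolding erank_def by simp
qed

lemma erank_empty [simp]: "erank f {} = 0"
  by (simp add: erank_def)

lemma erank_insert_redundant:
  assumes "finite_edges f F" "f e = {u, v}" "(u, v) \<in> conn f F"
  shows "erank f (insert e F) = erank f F"
proof -
  let ?V = "\<Union>(f ` insert e F)"
  have fin: "finite ?V"
    using assms finite_Union_ends[of f F] by auto
  have "ncomp f ?V (insert e F) = ncomp f ?V F"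
    unfolding ncomp_def conn_insert_redundant[where f = f, OF assms(2,3)] ..
  then show ?thesis
    using erank_ncomp[where f = f, OF fin, of "insert e F"] erank_ncomp[where f = f, OF fin, of F]
    by auto
qed

text \<open>The counting behind the insertion of an edge between two components: \<open>c\<close>
  and \<open>c'\<close> give the class of a vertex before and after the merge.\<close>

lemma card_merge_classes:
  fixes c c' :: "'v \<Rightarrow> 'v set"
  assumes "finite V" "u \<in> V" "v \<in> V" "c u \<noteq> c v"
    and self: "\<And>w. w \<in> c w" and cls: "\<And>w x. x \<in> c w \<Longrightarrow> c x = c w"
    and c': "\<And>w. c' w = (if c w = c u \<or> c w = c v then c u \<union> c v else c w)"
  shows "card (c ` V) = Suc (card (c' ` V))"
proof -
  let ?A = "c ` V - {c u, c v}"
  have c'_merged: "c' w = c u \<union> c v" if "c w = c u \<or> c w = c v" for w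
    using c'[of w] that by presburger
  have c'_other: "c' w = c w" if "\<not> (c w = c u \<or> c w = c v)" for w
    using c'[of w] that by presburger
  have "c' ` V = insert (c u \<union> c v) ?A"
  proof (intro equalityI subsetI)
    fix C assume "C \<in> c' ` V"
    then obtain w where "w \<in> V" "C = c' w"
      by blast
    then show "C \<in> insert (c u \<union> c v) ?A"
      by (cases "c w = c u \<or> c w = c v") (simp_all add: c'_merged c'_other)
  next
    fix C assume "C \<in> insert (c u \<union> c v) ?A"
    then consider "C = c' u" | w where "w \<in> V" "C = c w" "c w \<noteq> c u" "c w \<noteq> c v"
      using c'_merged[of u] by blast
    then show "C \<in> c' ` V"
    proof cases
      case 2
      then have "C = c' w"
        using c'_other[of w] by metis
      then show ?thesis
        using 2(1) by blast
    qed (use assms(2) in blast)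
  qed
  \<comment> \<open>A class equal to the union would contain \<open>u\<close> and hence be
    \<open>c u\<close> itself, which was removed.\<close>
  moreover have "c u \<union> c v \<notin> ?A"
  proof
    assume "c u \<union> c v \<in> ?A"
    then obtain w where "c u \<union> c v = c w" "c w \<noteq> c u"
      by auto
    then show False
      using self[of u] cls[of u w] by blast
  qed
  ultimately have "card (c' ` V) = Suc (card ?A)"
    using assms(1) by simp
  moreover have "card (c ` V) = card ?A + card {c u, c v}"
  proof -
    have "{c u, c v} \<subseteq> c ` V"
      using assms(2,3) by blast
    then show ?thesis
      using assms(1) by (metis card_Diff_subset card_mono finite.emptyI finite.insertI finite_imageI
          le_add_diff_inverse2)
  qed
  ultimately show ?thesis
    using assms(4) by simp
qed

text \<open>Over the fixed vertex set \<open>?V\<close>, the new edge merges exactly the classes of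
  \<open>u\<close> and \<open>v\<close>.\<close>

lemma erank_insert_bridge:
  assumes "finite_edges f F" "f e = {u, v}" "(u, v) \<notin> conn f F"
  shows "erank f (insert e F) = Suc (erank f F)"
proof -
  let ?V = "\<Union>(f ` insert e F)"
  let ?c = "\<lambda>v. conn f F `` {v}" and ?c' = "\<lambda>v. conn f (insert e F) `` {v}"
  have fin: "finite ?V"
    using assms finite_Union_ends[of f F] by auto
  have "?c' w = (if ?c w = ?c u \<or> ?c w = ?c v then ?c u \<union> ?c v else ?c w)" for w
  proof (rule set_eqI)
    fix x
    consider "(w, u) \<in> conn f F" | "(w, v) \<in> conn f F"
      | "(w, u) \<notin> conn f F" "(w, v) \<notin> conn f F"
      by blast
    then show "x \<in> ?c' w \<longleftrightarrow> x \<in> (if ?c w = ?c u \<or> ?c w = ?c v then ?c u \<union> ?c v else ?c w)"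
    proof cases
      case 1
      have "(u, x) \<in> conn f F" if "(w, x) \<in> conn f F"
        using conn_trans[OF conn_sym[OF 1] that] .
      then show ?thesis
        unfolding class_eq_iff Image_singleton_iff conn_insert_iff[where f = f, OF assms(2)]
        using 1 by (simp only: if_True Un_iff Image_singleton_iff simp_thms) blast
    next
      case 2
      have "(v, x) \<in> conn f F" if "(w, x) \<in> conn f F"
        using conn_trans[OF conn_sym[OF 2] that] .
      then show ?thesis
        unfolding class_eq_iff Image_singleton_iff conn_insert_iff[where f = f, OF assms(2)]
        using 2 by (simp only: if_True Un_iff Image_singleton_iff simp_thms) blast
    next
      case 3
      then show ?thesis
        unfolding class_eq_iff Image_singleton_iff conn_insert_iff[where f = f, OF assms(2)]
        by (simp only: if_False Image_singleton_iff simp_thms)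
    qed
  qed
  moreover have "?c u \<noteq> ?c v"
    using assms(3) by (simp only: class_eq_iff not_False_eq_True)
  moreover have "u \<in> ?V" "v \<in> ?V"
    using assms(2) by simp_all
  moreover have "?c x = ?c w" if "x \<in> ?c w" for w x
    using that conn_sym by (simp only: class_eq_iff Image_singleton_iff) fast
  ultimately have "ncomp f ?V F = Suc (ncomp f ?V (insert e F))"
    unfolding ncomp_def using fin by (intro card_merge_classes[where u = u and v = v]) (assumption | simp)+
  then show ?thesis
    using erank_ncomp[where f = f, OF fin, of "insert e F"] erank_ncomp[where f = f, OF fin, of F]
    by auto
qed

text \<open>Most later properties of \<open>erank\<close> follow from this increment rule by
  inserting edges one at a time and comparing reachability.\<close>

lemma erank_insert:
  assumes "finite_edges f F" "f e = {u, v}"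
  shows "erank f (insert e F) = erank f F + (if (u, v) \<in> conn f F then 0 else 1)"
  using erank_insert_redundant[OF assms] erank_insert_bridge[OF assms] by simp

section \<open>Submodularity and forests\<close>

lemma finite_edges_induct [consumes 1, case_names empty insert]:
  assumes "finite_edges f F" "P {}"
    and "\<And>e u v K. finite_edges f K \<Longrightarrow> insert e K \<subseteq> F \<Longrightarrow> e \<notin> K \<Longrightarrow> f e = {u, v} \<Longrightarrow> P K \<Longrightarrow> P (insert e K)"
  shows "P F"
proof -
  have "finite F" using assms(1) by (rule finite_edgesD)
  have "P K" if "finite K" "K \<subseteq> F" for K
    using that
  proof (induction K rule: finite_induct)
    case (insert e K)
    obtain u v where "f e = {u, v}"
      using assms(1) insert.prems by (meson finite_edgesE insert_subset)
    then show ?case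
      using insert finite_edges_subset[OF assms(1), of K] by (intro assms(3)) auto
  qed (rule assms(2))
  then show ?thesis
    using \<open>finite F\<close> by blast
qed

text \<open>Submodularity as diminishing returns: while the edges of \<open>B\<close> are inserted,
  whatever is connected over \<open>A\<close> is connected over \<open>A'\<close>, so the larger set
  never gains more.\<close>

lemma erank_submodular:
  assumes "finite_edges f A'" "finite_edges f B" "A \<subseteq> A'"
  shows "erank f (A' \<union> B) + erank f A \<le> erank f (A \<union> B) + erank f A'"
  using assms(2)
proof (induction rule: finite_edges_induct)
  case empty
  then show ?case by simp
next
  case (insert e u v K)
  have fin: "finite_edges f (A' \<union> K)" "finite_edges f (A \<union> K)"
    using insert.hyps assms finite_edges_subset by (auto intro!: finite_edges_Un)
  have "conn f (A \<union> K) \<subseteq> conn f (A' \<union> K)"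
    using assms(3) by (intro conn_mono) auto
  then show ?case
    using insert.IH erank_insert[OF fin(1) insert.hyps(4)] erank_insert[OF fin(2) insert.hyps(4)]
    by (auto split: if_splits)
qed

lemma erank_mono:
  assumes "finite_edges f K" "F \<subseteq> K"
  shows "erank f F \<le> erank f K"
proof -
  have finF: "finite_edges f F"
    using assms by (rule finite_edges_subset)
  have "erank f F \<le> erank f (F \<union> K)"
    using assms(1)
  proof (induction rule: finite_edges_induct)
    case (insert e u v K)
    have "finite_edges f (F \<union> K)"
      using insert.hyps finF by (intro finite_edges_Un)
    from erank_insert[OF this insert.hyps(4)] show ?case
      using insert.IH by simp
  qed simp
  then show ?thesis
    using assms(2) by (simp add: Un_absorb1)
qed

lemma erank_Un_le_card:
  assumes "finite_edges f F" "finite_edges f K"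
  shows "erank f (F \<union> K) \<le> erank f F + card K"
  using assms(2)
proof (induction rule: finite_edges_induct)
  case (insert e u v K)
  have "finite_edges f (F \<union> K)"
    using insert.hyps assms(1) by (intro finite_edges_Un)
  moreover have "finite K"
    using insert.hyps by (simp add: finite_edgesD)
  ultimately show ?case
    using insert.IH insert.hyps erank_insert[of f "F \<union> K" e u v] by simp
qed simp

lemma erank_le_card: "finite_edges f F \<Longrightarrow> erank f F \<le> card F"
  using erank_Un_le_card[of f "{}" F] by simp

text \<open>Rank equal to size characterises forests. Removing edges lowers the rank by at most
  their number, so no defect can appear in a subset.\<close>

lemma forest_subset:
  assumes "finite_edges f K" "erank f K = card K" "F \<subseteq> K"
  shows "erank f F = card F"
proof -
  have fin: "finite_edges f F" "finite_edges f (K - F)"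
    using assms by (auto intro: finite_edges_subset[of f K])
  have "F \<union> (K - F) = K"
    using assms(3) by blast
  then have "card K \<le> erank f F + card (K - F)"
    using erank_Un_le_card[OF fin] assms(2) by simp
  moreover have "card K = card F + card (K - F)"
    using assms(3) finite_edgesD[OF assms(1)]
    by (metis card_Diff_subset card_mono finite_subset le_add_diff_inverse)
  ultimately show ?thesis
    using erank_le_card[OF fin(1)] by simp
qed

text \<open>Greedy construction: starting from \<open>B\<close>, an edge of \<open>F\<close> is kept
  iff it joins two classes. The induction also carries equality of reachability for \<open>C\<close>
  and \<open>B \<union> K\<close>, so that the test gives the same answer for both.\<close>

lemma maximal_forest:
  assumes "finite_edges f F" "B \<subseteq> F" "erank f B = card B"
  obtains C where "B \<subseteq> C" "C \<subseteq> F" "erank f C = card C" "erank f C = erank f F"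
proof -
  have finB: "finite_edges f B"
    using assms finite_edges_subset by blast
  have "\<exists>C. B \<subseteq> C \<and> C \<subseteq> B \<union> F \<and> erank f C = card C \<and> erank f C = erank f (B \<union> F) \<and>
      conn f C = conn f (B \<union> F)"
    using assms(1)
  proof (induction rule: finite_edges_induct)
    case empty
    then show ?case
      using assms(3) by (intro exI[of _ B]) simp
  next
    case (insert e u v K)
    then obtain C where C: "B \<subseteq> C" "C \<subseteq> B \<union> K" "erank f C = card C"
        "erank f C = erank f (B \<union> K)" "conn f C = conn f (B \<union> K)"
      by blast
    have fin: "finite_edges f (B \<union> K)"
      using finB insert.hyps by (intro finite_edges_Un)
    have finC: "finite_edges f C"
      using C fin finite_edges_subset by blast
    show ?case
    proof (cases "(u, v) \<in> conn f (B \<union> K)")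
      case True
      then show ?thesis
        using C erank_insert_redundant[OF fin insert.hyps(4)] conn_insert_redundant[where f = f, OF insert.hyps(4)]
        by (intro exI[of _ C]) auto
    next
      case False
      then have "(u, v) \<notin> conn f C"
        using C by simp
      moreover from this have "e \<notin> C"
        using insert.hyps(4) conn_edge by metis
      ultimately show ?thesis
        using C erank_insert_bridge[OF fin insert.hyps(4) False]
          erank_insert_bridge[OF finC insert.hyps(4)] conn_insert_cong[OF C(5), of e]
          finite_edgesD[OF finC]
        by (intro exI[of _ "insert e C"]) auto
    qed
  qed
  then show ?thesis
    using that assms(2) by (auto simp: Un_absorb1)
qed

section \<open>Rank of connected sets and of unions glued at a vertex\<close>

lemma erank_connected_iff:
  assumes "finite V" "V \<noteq> {}" "\<Union>(f ` F) \<subseteq> V"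
  shows "Suc (erank f F) = card V \<longleftrightarrow> (\<forall>u\<in>V. \<forall>v\<in>V. (u, v) \<in> conn f F)"
proof -
  let ?I = "(\<lambda>v. conn f F `` {v}) ` V"
  have "Suc (erank f F) = card V \<longleftrightarrow> card ?I = 1"
    using erank_ncomp[OF assms(1,3)] unfolding ncomp_def by linarith
  also have "\<dots> \<longleftrightarrow> (\<forall>u\<in>V. \<forall>v\<in>V. conn f F `` {u} = conn f F `` {v})"
  proof
    assume "card ?I = 1"
    then obtain C where "?I = {C}"
      by (rule card_1_singletonE)
    then show "\<forall>u\<in>V. \<forall>v\<in>V. conn f F `` {u} = conn f F `` {v}"
      by (metis (no_types, lifting) imageI singletonD)
  next
    assume eq: "\<forall>u\<in>V. \<forall>v\<in>V. conn f F `` {u} = conn f F `` {v}"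
    obtain a where "a \<in> V"
      using assms(2) by blast
    then have "?I = {conn f F `` {a}}"
      using eq by blast
    then show "card ?I = 1"
      by simp
  qed
  finally show ?thesis
    unfolding class_eq_iff .
qed

text \<open>All vertices outside \<open>W\<close> are retracted to \<open>c\<close>. Edges of
  \<open>X\<close> meet \<open>W\<close> at most in \<open>c\<close>, so they collapse to
  \<open>c\<close>, and a path in the union becomes a path in \<open>Y\<close>.\<close>

lemma conn_one_sum:
  assumes "(u, v) \<in> conn f (X \<union> Y)" "\<Union>(f ` Y) \<subseteq> W" "\<Union>(f ` X) \<inter> W \<subseteq> {c}" "u \<in> W" "v \<in> W"
  shows "(u, v) \<in> conn f Y"
proof -
  let ?h = "\<lambda>w. if w \<in> W then w else c"
  have "(?h u, ?h v) \<in> conn f Y"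
  proof (rule conn_hom[OF assms(1)])
    fix e x y assume e: "e \<in> X \<union> Y" "f e = {x, y}"
    show "(?h x, ?h y) \<in> conn f Y"
    proof (cases "e \<in> Y")
      case True
      then have "x \<in> W" "y \<in> W"
        using e assms(2) by auto
      then show ?thesis
        using conn_edge[of e Y f x y] True e by simp
    next
      case False
      then have "?h x = c" "?h y = c"
        using e assms(3) by auto
      then show ?thesis
        by (simp only: conn_refl)
    qed
  qed
  then show ?thesis
    using assms by simp
qed

text \<open>By \<open>conn_one_sum\<close>, \<open>X\<close> creates no new connection between
  vertices of \<open>Y\<close>, so each edge of \<open>Y\<close> raises the rank equally with or
  without \<open>X\<close>.\<close>

lemma erank_one_sum:
  assumes "finite_edges f X" "finite_edges f Y" "\<Union>(f ` X) \<inter> \<Union>(f ` Y) \<subseteq> {c}"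
  shows "erank f (X \<union> Y) = erank f X + erank f Y"
proof -
  let ?W = "\<Union>(f ` Y)"
  show ?thesis
    using assms(2)
  proof (induction rule: finite_edges_induct)
    case (insert e u v K)
    have fin: "finite_edges f (X \<union> K)"
      using insert.hyps assms(1) by (intro finite_edges_Un)
    have W: "u \<in> ?W" "v \<in> ?W" "\<Union>(f ` K) \<subseteq> ?W"
      using insert.hyps by auto
    have "(u, v) \<in> conn f (X \<union> K) \<longleftrightarrow> (u, v) \<in> conn f K"
      using conn_one_sum[OF _ W(3) assms(3) W(1,2)] conn_mono[of K "X \<union> K" f] by auto
    then show ?case
      using insert.IH erank_insert[OF fin insert.hyps(4)] erank_insert[OF insert.hyps(1,4)]
      by simp
  qed simp
qed

section \<open>Matroid connectedness of an edge set\<close>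

text \<open>Matroid 2-connectedness with \<open>erank\<close> as the rank function, stated for bare
  edge sets so that it also applies to contractions.\<close>

definition rank_connected :: "('e \<Rightarrow> 'v set) \<Rightarrow> 'e set \<Rightarrow> bool" where
  "rank_connected f D \<longleftrightarrow> \<not> (\<exists>X. X \<noteq> {} \<and> X \<subset> D \<and> erank f D = erank f X + erank f (D - X))"

lemma rank_connectedD:
  "rank_connected f D \<Longrightarrow> X \<subseteq> D \<Longrightarrow> erank f D = erank f X + erank f (D - X) \<Longrightarrow> X = {} \<or> X = D"
  unfolding rank_connected_def by blast

text \<open>A 2-connected edge set has no cut vertex: two parts sharing at most one vertex have
  additive rank. Parts with no common vertex are included.\<close>

lemma rank_connected_one_sum:
  assumes "finite_edges f D" "rank_connected f D" "X \<subseteq> D" "\<Union>(f ` X) \<inter> \<Union>(f ` (D - X)) \<subseteq> {c}"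
  shows "X = {} \<or> X = D"
proof (rule rank_connectedD[OF assms(2,3)])
  have "X \<union> (D - X) = D"
    using assms(3) by blast
  then show "erank f D = erank f X + erank f (D - X)"
    using erank_one_sum[of f X "D - X" c] assms finite_edges_subset[OF assms(1)]
    by (metis Diff_subset)
qed

text \<open>A loop has rank 0 and its removal leaves the rank unchanged, so it splits off. The bound
  on \<open>card D\<close> excludes a single loop, whose matroid is 2-connected.\<close>

lemma rank_connected_loopless:
  assumes "finite_edges f D" "rank_connected f D" "card D \<ge> 2" "e \<in> D" "f e = {u, v}"
  shows "u \<noteq> v"
proof
  assume "u = v"
  have "erank f (insert e K) = erank f K" if "K \<subseteq> D" for K
    using finite_edges_subset[OF assms(1) that] assms(5)
    by (rule erank_insert_redundant) (unfold \<open>u = v\<close>, rule conn_refl)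
  from this[of "{}"] this[of "D - {e}"] have "erank f D = erank f {e} + erank f (D - {e})"
    using assms(4) by (simp add: insert_absorb)
  then have "D = {e}"
    using rank_connectedD[OF assms(2), of "{e}"] assms(4) by simp
  then show False
    using assms(3) by simp
qed

text \<open>The edges meeting the component of \<open>u\<close> share no vertex with the other
  edges, so a second component would give a separation.\<close>

lemma rank_connected_conn:
  assumes "finite_edges f D" "rank_connected f D" "u \<in> \<Union>(f ` D)" "v \<in> \<Union>(f ` D)"
  shows "(u, v) \<in> conn f D"
proof (rule ccontr)
  define C where "C = {w. (u, w) \<in> conn f D}"
  define X where "X = {e \<in> D. f e \<inter> C \<noteq> {}}"
  assume uv: "(u, v) \<notin> conn f D"
  have X: "f e \<subseteq> C" if eX: "e \<in> X" for e
  proof -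
    obtain y where y: "y \<in> f e" "y \<in> C" and e: "e \<in> D"
      using eX unfolding X_def by blast
    obtain p q where pq: "f e = {p, q}"
      using assms(1) e by (rule finite_edgesE)
    have "(p, q) \<in> conn f D"
      using e pq by (rule conn_edge)
    then have "(y, z) \<in> conn f D" if "z \<in> {p, q}" for z
      using that y(1) conn_sym[of p q f D] conn_refl[of p f D] conn_refl[of q f D]
      unfolding pq by blast
    then show ?thesis
      using y(2) conn_trans[of u y] unfolding C_def pq by blast
  qed
  have "X \<subseteq> D"
    unfolding X_def by blast
  moreover have "\<Union>(f ` X) \<inter> \<Union>(f ` (D - X)) \<subseteq> {u}"
    using X X_def by blast
  ultimately have "X = {} \<or> X = D"
    using rank_connected_one_sum assms(1,2) by metis
  moreover obtain eu ev where "eu \<in> D" "u \<in> f eu" "ev \<in> D" "v \<in> f ev"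
    using assms(3,4) by blast
  moreover have "u \<in> C" "v \<notin> C"
    using uv unfolding C_def by simp_all
  ultimately show False
    using X X_def by blast
qed

text \<open>Let \<open>C\<close> be the component of \<open>u\<close> once \<open>x\<close> is
  deleted. Edges meeting \<open>C\<close> have all their ends in \<open>C\<close> or at
  \<open>x\<close>, so if \<open>v\<close> were not in \<open>C\<close>, then \<open>x\<close> would
  be a cut vertex.\<close>

lemma rank_connected_delete_vertex:
  assumes "finite_edges f D" "rank_connected f D" "(u, v) \<in> conn f D" "u \<noteq> x" "v \<noteq> x"
  shows "(u, v) \<in> conn f {e \<in> D. x \<notin> f e}"
proof (rule ccontr)
  let ?D = "{e \<in> D. x \<notin> f e}"
  define C where "C = {w. (u, w) \<in> conn f ?D}"
  define X where "X = {e \<in> D. f e \<inter> C \<noteq> {}}"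
  assume uv: "(u, v) \<notin> conn f ?D"
  then have "u \<noteq> v"
    using conn_refl by metis
  then have "u \<in> \<Union>(f ` D)" "v \<in> \<Union>(f ` D)"
    using conn_isolated[OF assms(3)] conn_isolated[OF conn_sym[OF assms(3)]] by metis+
  then obtain eu ev where eu: "eu \<in> D" "u \<in> f eu" and ev: "ev \<in> D" "v \<in> f ev"
    by blast
  have "u \<in> C"
    unfolding C_def by simp
  have "x \<notin> C"
  proof
    assume "x \<in> C"
    then have "(x, u) \<in> conn f ?D"
      unfolding C_def by (simp add: conn_sym)
    from conn_isolated[OF this] show False
      using assms(4) by blast
  qed
  have X: "f e \<subseteq> insert x C" if eX: "e \<in> X" for e
  proof (cases "x \<in> f e")
    case False
    obtain y where y: "y \<in> f e" "y \<in> C" and e: "e \<in> D"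
      using eX unfolding X_def by blast
    show ?thesis
    proof
      fix z assume "z \<in> f e"
      obtain p q where "f e = {p, q}"
        using assms(1) e by (rule finite_edgesE)
      then have "y = p \<or> y = q" "z = p \<or> z = q"
        using y(1) \<open>z \<in> f e\<close> by blast+
      then have "z = y \<or> f e = {y, z}"
        unfolding \<open>f e = {p, q}\<close> by blast
      then have "(y, z) \<in> conn f ?D"
      proof
        assume "f e = {y, z}"
        then show ?thesis
          using e False by (intro conn_edge[of e]) simp_all
      qed simp
      then show "z \<in> insert x C"
        using y(2) conn_trans unfolding C_def by fast
    qed
  next
    case True
    have "e \<in> D" "f e \<inter> C \<noteq> {}"
      using eX unfolding X_def by blast+
    obtain p q where "f e = {p, q}"
      using assms(1) \<open>e \<in> D\<close> by (rule finite_edgesE)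
    then show ?thesis
      using True \<open>x \<notin> C\<close> \<open>f e \<inter> C \<noteq> {}\<close> unfolding \<open>f e = {p, q}\<close> by blast
  qed
  have "\<Union>(f ` X) \<inter> \<Union>(f ` (D - X)) \<subseteq> {x}"
    using X X_def by blast
  moreover have "X \<subseteq> D"
    unfolding X_def by blast
  ultimately have "X = {} \<or> X = D"
    using rank_connected_one_sum assms(1,2) by metis
  moreover have "eu \<in> X"
    using eu \<open>u \<in> C\<close> X_def by blast
  moreover have "ev \<notin> X"
    using ev X[of ev] uv assms(5) C_def by blast
  ultimately show False
    using ev by blast
qed

text \<open>The converse of the preceding facts. In a separation, an edge of \<open>X\<close> and an
  edge of \<open>Y\<close> meet at a vertex \<open>x\<close>; as \<open>x\<close> is not a cut
  vertex, some cycle runs through both edges, which additivity of the rank forbids.\<close>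

lemma rank_connectedI:
  assumes fin: "finite_edges f D"
    and loopless: "\<And>e u v. e \<in> D \<Longrightarrow> f e = {u, v} \<Longrightarrow> u \<noteq> v"
    and connected: "\<And>u v. u \<in> \<Union>(f ` D) \<Longrightarrow> v \<in> \<Union>(f ` D) \<Longrightarrow> (u, v) \<in> conn f D"
    and delete: "\<And>x u v. u \<in> \<Union>(f ` D) - {x} \<Longrightarrow> v \<in> \<Union>(f ` D) - {x} \<Longrightarrow>
      (u, v) \<in> conn f {e \<in> D. x \<notin> f e}"
  shows "rank_connected f D"
  unfolding rank_connected_def
proof
  assume "\<exists>X. X \<noteq> {} \<and> X \<subset> D \<and> erank f D = erank f X + erank f (D - X)"
  then obtain X where X: "X \<noteq> {}" "X \<subset> D" "erank f D = erank f X + erank f (D - X)"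
    by blast
  define Y where "Y = D - X"
  have D: "X \<union> Y = D" and "Y \<noteq> {}" and sub: "X \<subseteq> D" "Y \<subseteq> D"
    using X(1,2) Y_def by blast+
  have finXY: "finite_edges f X" "finite_edges f Y"
    using finite_edges_subset[OF fin] sub by blast+
  \<comment> \<open>The rank is additive across the separation: by submodularity a defect of a smaller pair
    of sets would persist up to \<open>X\<close> and \<open>Y\<close>.\<close>
  have additive: "erank f (A \<union> B) = erank f A + erank f B" if "A \<subseteq> X" "B \<subseteq> Y" for A B
  proof -
    have finAB: "finite_edges f A" "finite_edges f B"
      using finXY that finite_edges_subset by blast+
    have "erank f (X \<union> B) + erank f A \<le> erank f (A \<union> B) + erank f X"
      using finXY finAB that by (intro erank_submodular)
    moreover have "erank f (Y \<union> X) + erank f B \<le> erank f (B \<union> X) + erank f Y"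
      using finXY that by (intro erank_submodular)
    moreover have "erank f (A \<union> B) + erank f {} \<le> erank f ({} \<union> B) + erank f A"
      using finAB by (intro erank_submodular) auto
    moreover have "erank f (X \<union> Y) = erank f X + erank f Y"
      using X(3) unfolding D unfolding Y_def .
    ultimately show ?thesis
      by (simp add: Un_commute)
  qed
  \<comment> \<open>Otherwise the vertices of \<open>X\<close> are closed under all edges of
    \<open>D\<close>, so no vertex of \<open>Y\<close> could be reached from them.\<close>
  have "\<exists>e e' x. e \<in> X \<and> e' \<in> Y \<and> x \<in> f e \<and> x \<in> f e'"
  proof (rule ccontr)
    assume "\<not> (\<exists>e e' x. e \<in> X \<and> e' \<in> Y \<and> x \<in> f e \<and> x \<in> f e')"
    then have disj: "f e \<inter> f e' = {}" if "e \<in> X" "e' \<in> Y" for e e'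
      using that by blast
    obtain e e' where ee': "e \<in> X" "e' \<in> Y"
      using X(1) \<open>Y \<noteq> {}\<close> by blast
    moreover obtain u v where "f e = {u, v}"
      using finXY(1) ee'(1) by (rule finite_edgesE)
    moreover obtain u' v' where "f e' = {u', v'}"
      using finXY(2) ee'(2) by (rule finite_edgesE)
    ultimately have u: "u \<in> \<Union>(f ` X)" "u' \<in> \<Union>(f ` Y)"
      by blast+
    have "u' \<in> \<Union>(f ` X)"
    proof (rule conn_closed[OF connected])
      show "u \<in> \<Union>(f ` D)" "u' \<in> \<Union>(f ` D)" "u \<in> \<Union>(f ` X)"
        using u sub by blast+
      show "f d \<subseteq> \<Union>(f ` X)" if "d \<in> D" "f d \<inter> \<Union>(f ` X) \<noteq> {}" for d
      proof -
        have "d \<in> X \<or> d \<in> Y"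
          using that(1) unfolding Y_def by blast
        then show ?thesis
          using that(2) disj by blast
      qed
    qed
    then show False
      using u disj by blast
  qed
  then obtain e e' x where e: "e \<in> X" and e': "e' \<in> Y" and x: "x \<in> f e" "x \<in> f e'"
    by (elim exE conjE)
  have other_end: "\<exists>w. f d = {x, w}" if "d \<in> D" "x \<in> f d" for d
    using fin \<open>d \<in> D\<close>
  proof (rule finite_edgesE)
    fix p q assume pq: "f d = {p, q}"
    then have "x = p \<or> x = q"
      using \<open>x \<in> f d\<close> by simp
    then have "f d = {x, q} \<or> f d = {x, p}"
      unfolding pq by (metis insert_commute)
    then show ?thesis
      by metis
  qed
  obtain a b where a: "f e = {x, a}" and b: "f e' = {x, b}"
    using other_end[of e] other_end[of e'] e e' x sub by blast
  have ab: "x \<noteq> a" "x \<noteq> b"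
    using loopless[OF _ a] loopless[OF _ b] e e' sub by blast+
  \<comment> \<open>Close up \<open>e\<close> and \<open>e'\<close> by a path avoiding \<open>x\<close>: then \<open>e'\<close> does not increase the rank of
    \<open>F \<union> {e}\<close>, although within \<open>Y\<close> it is the only edge at \<open>x\<close>.\<close>
  let ?F = "{d \<in> D. x \<notin> f d}"
  have finF: "finite_edges f (insert e ?F)" "finite_edges f (?F \<inter> Y)"
    using e sub by (blast intro: finite_edges_subset[OF fin])+
  have "(a, b) \<in> conn f ?F"
    using a b ab e e' sub by (intro delete) blast+
  then have "(a, b) \<in> conn f (insert e ?F)"
    using conn_mono[of ?F "insert e ?F" f] by blast
  from conn_trans[OF conn_edge[where f = f, OF insertI1 a] this] have "(x, b) \<in> conn f (insert e ?F)" .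
  then have *: "erank f (insert e' (insert e ?F)) = erank f (insert e ?F)"
    by (rule erank_insert_redundant[where f = f, OF finF(1) b])
  have "(x, b) \<notin> conn f (?F \<inter> Y)"
  proof
    assume "(x, b) \<in> conn f (?F \<inter> Y)"
    then have "b = x"
      by (rule conn_isolated) blast
    then show False
      using ab(2) by simp
  qed
  then have "erank f (insert e' (?F \<inter> Y)) = Suc (erank f (?F \<inter> Y))"
    by (rule erank_insert_bridge[where f = f, OF finF(2) b])
  moreover have split: "insert e ?F = insert e (?F \<inter> X) \<union> (?F \<inter> Y)"
      "insert e' (insert e ?F) = insert e (?F \<inter> X) \<union> insert e' (?F \<inter> Y)"
    unfolding Y_def by blast+
  moreover have "erank f (insert e (?F \<inter> X) \<union> (?F \<inter> Y)) = erank f (insert e (?F \<inter> X)) + erank f (?F \<inter> Y)"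
      "erank f (insert e (?F \<inter> X) \<union> insert e' (?F \<inter> Y)) =
        erank f (insert e (?F \<inter> X)) + erank f (insert e' (?F \<inter> Y))"
    using e e' by (intro additive; blast)+
  ultimately show False
    using * unfolding split(2) unfolding split(1) by linarith
qed

section \<open>Contraction of a connected subgraph\<close>

text \<open>\<open>W\<close> is contracted to one of its own vertices \<open>c\<close>, so that
  vertex and edge types stay the same and only the incidence function changes. \<open>W\<close> is
  given besides \<open>L\<close> to admit a single vertex without edges.\<close>

locale contraction =
  fixes f :: "'e \<Rightarrow> 'v set" and L :: "'e set" and W :: "'v set" and c :: 'v
  assumes finL: "finite_edges f L" and c: "c \<in> W" and ends: "\<Union>(f ` L) \<subseteq> W"
    and connected: "\<And>u v. u \<in> W \<Longrightarrow> v \<in> W \<Longrightarrow> (u, v) \<in> conn f L"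
begin

definition proj :: "'v \<Rightarrow> 'v" where
  "proj v = (if v \<in> W then c else v)"

definition cends :: "'e \<Rightarrow> 'v set" where
  "cends e = proj ` f e"

lemma proj_inside [simp]: "v \<in> W \<Longrightarrow> proj v = c"
  and proj_outside [simp]: "v \<notin> W \<Longrightarrow> proj v = v"
  by (simp_all add: proj_def)

lemma conn_proj: "(v, proj v) \<in> conn f L"
  using connected[OF _ c] conn_refl by (cases "v \<in> W") auto

text \<open>Paths project to the contraction, where edges of \<open>L\<close> become trivial.
  Conversely, \<open>proj\<close> moves a vertex only within its \<open>L\<close>-component, so
  paths of the contraction lift once \<open>L\<close> is available.\<close>

lemma conn_cends_iff:
  assumes "finite_edges f K"
  shows "(proj u, proj v) \<in> conn cends K \<longleftrightarrow> (u, v) \<in> conn f (K \<union> L)"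
proof
  assume uv: "(u, v) \<in> conn f (K \<union> L)"
  show "(proj u, proj v) \<in> conn cends K"
  proof (rule conn_hom[OF uv])
    fix e x y assume e: "e \<in> K \<union> L" "f e = {x, y}"
    show "(proj x, proj y) \<in> conn cends K"
    proof (cases "e \<in> K")
      case True
      then show ?thesis
        using e(2) by (intro conn_edge[of e]) (simp_all add: cends_def)
    next
      case False
      then have "x \<in> W" "y \<in> W"
        using e ends by auto
      then show ?thesis
        by simp
    qed
  qed
next
  have L: "conn f L \<subseteq> conn f (K \<union> L)"
    by (rule conn_mono) blast
  have proj: "(w, proj w) \<in> conn f (K \<union> L)" for w
    using conn_proj L by blast
  have "conn cends K \<subseteq> conn f (K \<union> L)"
  proof (rule conn_subset)
    fix e p q assume e: "e \<in> K" "cends e = {p, q}"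
    obtain x y where xy: "f e = {x, y}"
      using assms e(1) by (rule finite_edgesE)
    then have "(x, y) \<in> conn f (K \<union> L)"
      using e(1) by (intro conn_edge[of e]) simp_all
    then have *: "(proj x, proj y) \<in> conn f (K \<union> L)"
      by (rule conn_trans[OF conn_sym[OF proj[of x]] conn_trans[OF _ proj[of y]]])
    have "p = proj x \<and> q = proj y \<or> p = proj y \<and> q = proj x"
      using e(2) xy by (auto simp: cends_def doubleton_eq_iff)
    then show "(p, q) \<in> conn f (K \<union> L)"
      using * conn_sym[OF *] by metis
  qed
  moreover assume "(proj u, proj v) \<in> conn cends K"
  ultimately have "(proj u, proj v) \<in> conn f (K \<union> L)"
    by blast
  then show "(u, v) \<in> conn f (K \<union> L)"
    using conn_trans[OF proj[of u] conn_trans[OF _ conn_sym[OF proj[of v]]]] by blast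
qed

lemma finite_edges_cends: "finite_edges f K \<Longrightarrow> finite_edges cends K"
  unfolding finite_edges_def cends_def by fastforce

text \<open>The rank formula of matroid contraction. By \<open>conn_cends_iff\<close> each inserted
  edge has the same increment on both sides; members of \<open>L\<close> in \<open>K\<close> count
  as loops.\<close>

lemma erank_cends:
  assumes "finite_edges f K"
  shows "erank f (K \<union> L) = erank cends K + erank f L"
  using assms
proof (induction rule: finite_edges_induct)
  case (insert e u v K)
  have fin: "finite_edges f (K \<union> L)" "finite_edges cends K"
    using finite_edges_Un[OF insert.hyps(1) finL] finite_edges_cends[OF insert.hyps(1)] .
  have e: "cends e = {proj u, proj v}"
    using insert.hyps(4) by (simp add: cends_def)
  show ?case
    using insert.IH erank_insert[OF fin(1) insert.hyps(4)] erank_insert[OF fin(2) e]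
    unfolding conn_cends_iff[OF insert.hyps(1)] by simp
qed simp

end

section \<open>Spanning trees and the rank function\<close>

lemma finite_multigraph_finite_edges: "finite_multigraph G \<Longrightarrow> finite_edges (ends G) (edges G)"
  unfolding finite_multigraph_def finite_edges_def
  by (metis card_1_singletonE card_2_iff insertE insert_absorb2 singletonD)

lemma finite_multigraph_ends: "finite_multigraph G \<Longrightarrow> F \<subseteq> edges G \<Longrightarrow> \<Union>(ends G ` F) \<subseteq> verts G"
  unfolding finite_multigraph_def by blast

section \<open>Walks and simple paths\<close>

lemma walk_conn: "walk G u p v \<Longrightarrow> (u, v) \<in> conn (ends G) (fst ` set p)"
proof (induction p arbitrary: u)
  case (Cons a p)
  obtain e w where a: "a = (e, w)"
    by force
  have "(w, v) \<in> conn (ends G) (fst ` set p)"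
    using Cons a by simp
  then have "(w, v) \<in> conn (ends G) (fst ` set (a # p))"
    using conn_mono[of "fst ` set p" "fst ` set (a # p)" "ends G"] by auto
  moreover have "(u, w) \<in> conn (ends G) (fst ` set (a # p))"
    using Cons.prems a by (intro conn_edge[of e]) simp_all
  ultimately show ?case
    by (rule conn_trans[rotated])
qed simp

lemma walk_edges: "walk G u p v \<Longrightarrow> fst ` set p \<subseteq> edges G"
  by (induction G u p v rule: walk.induct) simp_all

lemma walk_ends: "walk G u p v \<Longrightarrow> e \<in> fst ` set p \<Longrightarrow> ends G e \<subseteq> insert u (snd ` set p)"
  by (induction G u p v rule: walk.induct) auto

text \<open>If the first edge occurred again, its end \<open>u\<close> would be revisited. This
  supplies the distinctness of edges that \<open>cycle\<close> demands.\<close>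

lemma path_distinct_edges:
  "walk G u p v \<Longrightarrow> distinct (u # map snd p) \<Longrightarrow> distinct (map fst p)"
proof (induction p arbitrary: u)
  case (Cons a p)
  obtain e w where a: "a = (e, w)"
    by force
  have "e \<notin> fst ` set p"
  proof
    assume "e \<in> fst ` set p"
    then have "ends G e \<subseteq> insert w (snd ` set p)"
      using Cons.prems a by (intro walk_ends) auto
    then show False
      using Cons.prems a by auto
  qed
  then show ?case
    using Cons.IH[of w] Cons.prems a by simp
qed simp

lemma path_suffix:
  "walk G u p v \<Longrightarrow> distinct (u # map snd p) \<Longrightarrow> x \<in> insert u (snd ` set p) \<Longrightarrow>
    \<exists>q. walk G x q v \<and> distinct (x # map snd q) \<and> set q \<subseteq> set p"
proof (induction p arbitrary: u)
  case (Cons a p)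
  show ?case
  proof (cases "x = u")
    case False
    obtain e w where a: "a = (e, w)"
      by force
    then obtain q where "walk G x q v" "distinct (x # map snd q)" "set q \<subseteq> set p"
      using Cons.IH[of w] Cons.prems False by auto
    then show ?thesis
      by (intro exI[of _ q]) auto
  qed (use Cons.prems in blast)
qed auto

text \<open>A path to \<open>v\<close> is extended at its front, where \<open>walk\<close> recurses,
  which is why the induction runs over the reversed relation. If the new vertex already lies on the
  path, the suffix from there is taken.\<close>

lemma conn_path:
  assumes "(u, v) \<in> conn (ends G) F" "v \<in> verts G" "F \<subseteq> edges G" "finite_multigraph G"
  shows "\<exists>p. walk G u p v \<and> distinct (u # map snd p) \<and> fst ` set p \<subseteq> F"
  using conn_sym[OF assms(1)]
proof (induction rule: conn_induct)
  case refl
  show ?case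
    using assms(2) by (intro exI[of _ "[]"]) simp
next
  case (step x y e)
  then obtain p where p: "walk G x p v" "distinct (x # map snd p)" "fst ` set p \<subseteq> F"
    by blast
  show ?case
  proof (cases "y \<in> insert x (snd ` set p)")
    case True
    from path_suffix[OF p(1,2) True] show ?thesis
      using p(3) by (meson image_mono order_trans)
  next
    case False
    have "y \<in> verts G"
      using finite_multigraph_ends[OF assms(4,3)] step.hyps by auto
    then have "walk G y ((e, x) # p) v"
      using p(1) step.hyps assms(3) by (auto simp: insert_commute)
    then show ?thesis
      using p False step.hyps(2) by (intro exI[of _ "(e, x) # p"]) auto
  qed
qed

lemma connected_graph_iff:
  assumes "finite_multigraph G"
  shows "connected_graph G \<longleftrightarrow>
    verts G \<noteq> {} \<and> (\<forall>u\<in>verts G. \<forall>v\<in>verts G. (u, v) \<in> conn (ends G) (edges G))"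
proof -
  have "(\<exists>p. walk G u p v) \<longleftrightarrow> (u, v) \<in> conn (ends G) (edges G)" if "v \<in> verts G" for u v
  proof
    assume "\<exists>p. walk G u p v"
    then obtain p where "walk G u p v" ..
    then show "(u, v) \<in> conn (ends G) (edges G)"
      using walk_conn[of G u p v] walk_edges[of G u p v] conn_mono[of _ "edges G" "ends G"] by blast
  next
    assume "(u, v) \<in> conn (ends G) (edges G)"
    from conn_path[OF this that order_refl assms] show "\<exists>p. walk G u p v"
      by blast
  qed
  then show ?thesis
    unfolding connected_graph_def by simp
qed

section \<open>Rank criteria for connected graphs, forests and spanning trees\<close>

lemma connected_graph_iff_erank:
  assumes "finite_multigraph G" "verts G \<noteq> {}"
  shows "connected_graph G \<longleftrightarrow> Suc (erank (ends G) (edges G)) = card (verts G)"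
proof -
  have "finite (verts G)"
    using assms(1) unfolding finite_multigraph_def by blast
  from erank_connected_iff[where f = "ends G" and F = "edges G", OF this assms(2)
      finite_multigraph_ends[OF assms(1) order_refl]]
  show ?thesis
    unfolding connected_graph_iff[OF assms(1)] using assms(2) by argo
qed

text \<open>Without cycles, every inserted edge joins two components, since a simple path between
  its ends would close up to a cycle. Conversely, the first edge of a cycle is redundant, which
  pushes the rank below the number of edges.\<close>

lemma acyclic_iff_erank:
  assumes G: "finite_multigraph G"
  shows "\<not> (\<exists>u p. cycle G u p) \<longleftrightarrow> erank (ends G) (edges G) = card (edges G)"
proof
  assume acyclic: "\<not> (\<exists>u p. cycle G u p)"
  show "erank (ends G) (edges G) = card (edges G)"
    using finite_multigraph_finite_edges[OF G]
  proof (induction rule: finite_edges_induct)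
    case (insert e u v K)
    have u: "u \<in> verts G" "v \<in> verts G"
      using finite_multigraph_ends[OF G insert.hyps(2)] insert.hyps(4) by auto
    have "(u, v) \<notin> conn (ends G) K"
    proof
      assume "(u, v) \<in> conn (ends G) K"
      from conn_path[OF conn_sym[OF this] u(1) _ G] obtain p
        where p: "walk G v p u" "distinct (v # map snd p)" "fst ` set p \<subseteq> K"
        using insert.hyps(2) by blast
      \<comment> \<open>If \<open>e\<close> is a loop, \<open>p\<close> is empty and this is the
        cycle of length 1.\<close>
      have "cycle G u ((e, v) # p)"
        unfolding cycle_def
        using p insert.hyps u path_distinct_edges[OF p(1,2)] by auto
      then show False
        using acyclic by blast
    qed
    from erank_insert_bridge[where f = "ends G", OF insert.hyps(1,4) this] show ?case
      using insert.IH insert.hyps(3) finite_edgesD[OF insert.hyps(1)] by simp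
  qed simp
next
  assume forest: "erank (ends G) (edges G) = card (edges G)"
  have fin: "finite_edges (ends G) (edges G)"
    using G by (rule finite_multigraph_finite_edges)
  show "\<not> (\<exists>u p. cycle G u p)"
  proof
    assume "\<exists>u p. cycle G u p"
    then obtain u p where up: "cycle G u p"
      by blast
    moreover obtain e w q where p: "p = (e, w) # q"
      using up by (cases p) (auto simp: cycle_def)
    ultimately have walk: "walk G w q u" and e: "e \<in> edges G" "ends G e = {u, w}" "e \<notin> fst ` set q"
      by (auto simp: cycle_def)
    let ?K = "edges G - {e}"
    have "(w, u) \<in> conn (ends G) ?K"
      using walk_conn[OF walk] walk_edges[OF walk] e(3) conn_mono[of "fst ` set q" ?K "ends G"] by blast
    moreover have finK: "finite_edges (ends G) ?K"
      using fin by (rule finite_edges_subset) blast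
    ultimately have "erank (ends G) (insert e ?K) = erank (ends G) ?K"
      using erank_insert_redundant[where f = "ends G", OF _ e(2) conn_sym] by blast
    then have "card (edges G) \<le> card ?K"
      using forest erank_le_card[OF finK] e(1) by (simp add: insert_absorb)
    then show False
      using e(1) finite_edgesD[OF fin] by (metis card_Diff1_less not_less)
  qed
qed

lemma spanning_tree_iff_erank:
  assumes G: "finite_multigraph G" "verts G \<noteq> {}"
  shows "spanning_tree G T \<longleftrightarrow> T \<subseteq> edges G \<and> Suc (erank (ends G) T) = card (verts G) \<and>
    erank (ends G) T = card T"
proof (cases "T \<subseteq> edges G")
  case True
  let ?T = "\<lparr>verts = verts G, edges = T, ends = ends G\<rparr>"
  have "finite_multigraph ?T"
    using G(1) True finite_subset unfolding finite_multigraph_def by auto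
  from connected_graph_iff_erank[OF this] acyclic_iff_erank[OF this] show ?thesis
    unfolding spanning_tree_def tree_def using True G(2) by simp
qed (simp add: spanning_tree_def)

text \<open>Each \<open>T \<inter> X\<close> is a forest within \<open>X\<close>, which bounds the
  maximum. It is attained by extending a maximal forest of \<open>X\<close> to a spanning
  tree.\<close>

lemma rk_graphic_matroid:
  assumes G: "finite_multigraph G" "connected_graph G" and X: "X \<subseteq> edges G"
  shows "rk (graphic_matroid G) X = erank (ends G) X"
proof -
  have ne: "verts G \<noteq> {}"
    using G(2) by (simp add: connected_graph_def)
  note tree_iff = spanning_tree_iff_erank[OF G(1) ne]
  have fin: "finite_edges (ends G) (edges G)"
    using G(1) by (rule finite_multigraph_finite_edges)
  have finX: "finite_edges (ends G) X"
    using fin X by (rule finite_edges_subset)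
  have le: "card (T \<inter> X) \<le> erank (ends G) X" if "spanning_tree G T" for T
  proof -
    have T: "finite_edges (ends G) T" "erank (ends G) T = card T"
      using that fin finite_edges_subset unfolding tree_iff by blast+
    have "erank (ends G) (T \<inter> X) = card (T \<inter> X)"
      by (rule forest_subset[OF T]) blast
    then show ?thesis
      using erank_mono[OF finX, of "T \<inter> X"] by simp
  qed
  obtain B where B: "{} \<subseteq> B" "B \<subseteq> X" "erank (ends G) B = card B" "erank (ends G) B = erank (ends G) X"
    using maximal_forest[OF finX, of "{}"] by auto
  obtain T where T: "B \<subseteq> T" "T \<subseteq> edges G" "erank (ends G) T = card T"
      "erank (ends G) T = erank (ends G) (edges G)"
    using maximal_forest[OF fin _ B(3)] B(2) X by blast
  have span: "spanning_tree G T"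
    using T connected_graph_iff_erank[OF G(1) ne] G(2) unfolding tree_iff by simp
  have "card B \<le> card (T \<inter> X)"
    using T(1,2) B(2) finite_edgesD[OF finX] by (intro card_mono) auto
  then have "card (T \<inter> X) = erank (ends G) X"
    using le[OF span] B(3,4) by simp
  moreover have "finite {card (T \<inter> X) |T. spanning_tree G T}"
    by (rule finite_subset[of _ "{..erank (ends G) X}"]) (use le in auto)
  ultimately have "Max {card (T \<inter> X) |T. spanning_tree G T} = erank (ends G) X"
    using le span by (intro Max_eqI) force+
  then show ?thesis
    by (simp add: graphic_matroid_def)
qed

section \<open>Locked edge sets of a 2-connected graph\<close>

text \<open>Here \<open>(V, E)\<close> stands for \<open>G\<close> and \<open>(W, L)\<close> for
  \<open>H\<close>; \<open>cends\<close> on \<open>E - L\<close> is \<open>G/H\<close>. Of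
  \<open>H\<close> only connectedness is assumed, so both directions of the equivalence can be
  proved inside the locale.\<close>

locale contracted_graph = contraction f L W c
  for f :: "'e \<Rightarrow> 'v set" and L W c +
  fixes V :: "'v set" and E :: "'e set"
  assumes finV: "finite V" and finE: "finite_edges f E" and endsE: "\<Union>(f ` E) \<subseteq> V"
    and LE: "L \<subseteq> E" and WV: "W \<subseteq> V"
    and connectedE: "\<And>u v. u \<in> V \<Longrightarrow> v \<in> V \<Longrightarrow> (u, v) \<in> conn f E"
    and rank_connectedE: "rank_connected f E"
begin

section \<open>Ranks and vertex counts of the contracted graph\<close>

lemma fin_cends: "finite_edges cends (E - L)" and fin_outer: "finite_edges f (E - L)"
  and finW: "finite W"
proof -
  show "finite_edges f (E - L)"
    using finE by (rule finite_edges_subset) blast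
  then show "finite_edges cends (E - L)"
    by (rule finite_edges_cends)
  show "finite W"
    using WV finV by (rule finite_subset)
qed

lemma E_split: "(E - L) \<union> L = E"
  using LE by blast

lemma Suc_erank_E: "Suc (erank f E) = card V"
  using erank_connected_iff[OF finV _ endsE] c WV connectedE by blast

lemma Suc_erank_L: "Suc (erank f L) = card W"
  using erank_connected_iff[OF finW _ ends] c connected by blast

text \<open>\<open>G/H\<close> is connected and has the vertices of \<open>V - W\<close> together
  with \<open>c\<close>, so its rank is the number of vertices outside \<open>W\<close>.\<close>

lemma erank_outer: "erank cends (E - L) + card W = card V"
  using erank_cends[OF fin_outer] Suc_erank_E Suc_erank_L unfolding E_split by linarith

lemma conn_outer:
  assumes "u \<in> V" "v \<in> V"
  shows "(proj u, proj v) \<in> conn cends (E - L)"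
  using connectedE[OF assms] unfolding conn_cends_iff[OF fin_outer] E_split .

lemma outer_verts: "V - W \<subseteq> \<Union>(f ` (E - L))"
proof
  fix v assume v: "v \<in> V - W"
  have "(v, c) \<in> conn f E"
    using v c WV connectedE by blast
  then have "v \<in> \<Union>(f ` E)"
    using conn_isolated v c by fastforce
  then show "v \<in> \<Union>(f ` (E - L))"
    using v ends by blast
qed

text \<open>The complement of \<open>H\<close> covers every vertex outside \<open>W\<close> and,
  inside \<open>W\<close>, exactly the attachments. This relates condition (ii) to the dual
  rank.\<close>

lemma card_outer_verts:
  "card (\<Union>(f ` (E - L))) + card W = card V + card (W \<inter> \<Union>(f ` (E - L)))"
proof -
  let ?U = "\<Union>(f ` (E - L))"
  have "?U = (V - W) \<union> (W \<inter> ?U)"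
    using outer_verts endsE by blast
  then have "card ?U = card (V - W) + card (W \<inter> ?U)"
    using finV finW card_Un_disjoint[of "V - W" "W \<inter> ?U"] by (metis Diff_disjoint Int_commute
        Int_left_commute finite_Diff finite_Int inf_bot_right)
  moreover have "card (V - W) + card W = card V"
    using WV finV finW by (metis card_Diff_subset card_mono le_add_diff_inverse2)
  ultimately show ?thesis
    by linarith
qed

text \<open>Deleting \<open>c\<close> from \<open>G/H\<close> gives the subgraph of condition (iii):
  the edges avoiding \<open>c\<close> are those with no end in \<open>W\<close>, and
  \<open>proj\<close> fixes their ends.\<close>

lemma conn_avoiding: "conn cends {e \<in> E - L. c \<notin> cends e} = conn f {e \<in> E. f e \<subseteq> V - W}"
proof -
  have "e \<in> E - L \<and> c \<notin> cends e \<longleftrightarrow> e \<in> E \<and> f e \<subseteq> V - W" for e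
  proof (cases "e \<in> E \<and> f e \<inter> W = {}")
    case True
    \<comment> \<open>An edge has at least one end, so an edge without ends in \<open>W\<close>
      cannot belong to \<open>L\<close>.\<close>
    then obtain p q where pq: "f e = {p, q}"
      using finE finite_edgesE by metis
    then have "e \<notin> L"
      using True ends by blast
    moreover have "c \<notin> cends e"
      using True c unfolding cends_def proj_def by (auto split: if_splits)
    ultimately show ?thesis
      using True endsE by blast
  next
    case False
    then have "e \<notin> E \<or> c \<in> cends e"
      unfolding cends_def by force
    then show ?thesis
      using False by blast
  qed
  then have sets: "{e \<in> E - L. c \<notin> cends e} = {e \<in> E. f e \<subseteq> V - W}"
    by (rule Collect_cong)
  have "cends e = f e" if "f e \<subseteq> V - W" for e
    using that unfolding cends_def by force
  then show ?thesis
    unfolding sets conn_def by (intro arg_cong[where f = rtrancl]) (auto; metis)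
qed

lemma conn_avoiding_rank_connected:
  assumes "rank_connected cends (E - L)" "u \<in> V - W" "v \<in> V - W"
  shows "(u, v) \<in> conn f {e \<in> E. f e \<subseteq> V - W}"
proof -
  have "(u, v) \<in> conn cends (E - L)"
    using conn_outer[of u v] assms(2,3) by simp
  then show ?thesis
    using rank_connected_delete_vertex[OF fin_cends assms(1), of u v c] assms(2,3) c
    unfolding conn_avoiding by blast
qed

text \<open>An edge inside \<open>W\<close> missing from \<open>L\<close> would be a loop at
  \<open>c\<close>.\<close>

lemma rank_connected_outer_induced:
  assumes "rank_connected cends (E - L)" "card (E - L) \<ge> 2"
  shows "L = {e \<in> E. f e \<subseteq> W}"
proof
  show "L \<subseteq> {e \<in> E. f e \<subseteq> W}"
    using LE ends by blast
  show "{e \<in> E. f e \<subseteq> W} \<subseteq> L"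
  proof clarify
    fix e assume e: "e \<in> E" "f e \<subseteq> W"
    show "e \<in> L"
    proof (rule ccontr)
      assume "e \<notin> L"
      obtain p q where "f e = {p, q}"
        using finE e(1) by (rule finite_edgesE)
      then have "cends e = {c, c}"
        using e(2) unfolding cends_def by simp
      then show False
        using rank_connected_loopless[OF fin_cends assms] e(1) \<open>e \<notin> L\<close> by blast
    qed
  qed
qed

lemma outer_nonempty:
  assumes "card W < card V"
  shows "E - L \<noteq> {}"
proof -
  have "V - W \<noteq> {}"
    using assms finV finW WV by (metis Diff_eq_empty_iff nat_less_le subset_antisym)
  then show ?thesis
    using outer_verts by blast
qed

lemma card_E_ge_2:
  assumes "card W < card V" "L \<noteq> {}"
  shows "card E \<ge> 2"
proof -
  obtain a b where "a \<in> L" "b \<in> E - L"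
    using assms outer_nonempty by blast
  then have "{a, b} \<subseteq> E" "a \<noteq> b"
    using LE by blast+
  then show ?thesis
    using card_mono[of E "{a, b}"] finite_edgesD[OF finE] by simp
qed

text \<open>A single attachment would be a cut vertex of \<open>G\<close>, with \<open>L\<close> and
  \<open>E - L\<close> as the two nonempty sides.\<close>

lemma card_attachments_ge_2:
  assumes "card W < card V" "L \<noteq> {}"
  shows "card (W \<inter> \<Union>(f ` (E - L))) \<ge> 2"
proof (rule ccontr)
  let ?K = "W \<inter> \<Union>(f ` (E - L))"
  assume "\<not> card ?K \<ge> 2"
  moreover have finK: "finite ?K"
    using finW by simp
  ultimately have "card ?K = 0 \<or> card ?K = 1"
    by linarith
  then obtain x where "?K \<subseteq> {x}"
  proof
    assume "card ?K = 0"
    then show thesis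
      using that finK by (metis card_0_eq empty_subsetI)
  next
    assume "card ?K = 1"
    then show thesis
      using that by (metis card_1_singletonE order_refl)
  qed
  then have "\<Union>(f ` L) \<inter> \<Union>(f ` (E - L)) \<subseteq> {x}"
    using ends by blast
  then have "L = {} \<or> L = E"
    by (rule rank_connected_one_sum[OF finE rank_connectedE LE])
  then show False
    using assms outer_nonempty by blast
qed

text \<open>Connecting \<open>V - W\<close> takes at least \<open>card (V - W) - 1\<close> edges,
  and each attachment has a further outer edge of its own.\<close>

lemma card_outer_ge_spanning:
  assumes induced: "L = {e \<in> E. f e \<subseteq> W}" and "V - W \<noteq> {}"
    and avoid: "\<And>u v. u \<in> V - W \<Longrightarrow> v \<in> V - W \<Longrightarrow> (u, v) \<in> conn f {e \<in> E. f e \<subseteq> V - W}"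
  shows "card (V - W) + card (W \<inter> \<Union>(f ` (E - L))) \<le> Suc (card (E - L))"
proof -
  let ?K = "W \<inter> \<Union>(f ` (E - L))" and ?N = "{e \<in> E. f e \<subseteq> V - W}"
  have finN: "finite_edges f ?N"
    using finE by (rule finite_edges_subset) blast
  have "Suc (erank f ?N) = card (V - W)"
    using erank_connected_iff[of "V - W" f ?N] finV assms(2) avoid by blast
  then have "card (V - W) \<le> Suc (card ?N)"
    using erank_le_card[OF finN] by linarith
  moreover have "card ?K \<le> card (E - L - ?N)"
  proof -
    have "\<forall>w\<in>?K. \<exists>e. e \<in> E - L \<and> w \<in> f e"
      by blast
    then obtain s where s: "\<forall>w\<in>?K. s w \<in> E - L \<and> w \<in> f (s w)"
      by (rule bchoice[THEN exE])
    \<comment> \<open>An edge chosen for two attachments would lie inside \<open>W\<close> and hence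
      in \<open>L\<close>, as \<open>H\<close> is induced.\<close>
    have "inj_on s ?K"
    proof (rule inj_onI, rule ccontr)
      fix w w' assume w: "w \<in> ?K" "w' \<in> ?K" "s w = s w'" "w \<noteq> w'"
      have e: "s w \<in> E - L" "w \<in> f (s w)" "w' \<in> f (s w)"
        using bspec[OF s w(1)] bspec[OF s w(2)] w(3) by simp_all
      obtain p q where pq: "f (s w) = {p, q}"
        using fin_outer e(1) by (rule finite_edgesE)
      have "f (s w) \<subseteq> W"
        using e(2,3) w(1,2,4) unfolding pq by blast
      then show False
        using e(1) induced by blast
    qed
    moreover have "s ` ?K \<subseteq> E - L - ?N"
      using s by blast
    ultimately show ?thesis
      using finite_edgesD[OF fin_outer] by (intro card_inj_on_le) auto
  qed
  moreover have N: "?N \<subseteq> E - L"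
  proof
    fix e assume e: "e \<in> ?N"
    then obtain p q where "f e = {p, q}"
      using finN finite_edgesE by metis
    then show "e \<in> E - L"
      using e ends by blast
  qed
  have "card (E - L) = card ?N + card (E - L - ?N)"
    using card_mono[OF finite_edgesD[OF fin_outer] N] card_Diff_subset[OF finite_edgesD[OF finN] N]
    by linarith
  ultimately show ?thesis
    by linarith
qed

text \<open>Checks the criterion \<open>rank_connectedI\<close> for \<open>G/H\<close>: loops are
  excluded because \<open>H\<close> is induced and \<open>G\<close> is loopless, deletion of
  \<open>c\<close> is condition (iii), and deletion of another vertex is inherited from
  \<open>G\<close>.\<close>

lemma rank_connected_outerI:
  assumes induced: "L = {e \<in> E. f e \<subseteq> W}" and "card E \<ge> 2"
    and avoid: "\<And>u v. u \<in> V - W \<Longrightarrow> v \<in> V - W \<Longrightarrow> (u, v) \<in> conn f {e \<in> E. f e \<subseteq> V - W}"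
  shows "rank_connected cends (E - L)"
proof (rule rank_connectedI[OF fin_cends])
  have verts: "u \<in> V \<and> proj u = u \<and> (u \<in> V - W \<or> u = c)"
    if u: "u \<in> \<Union>(cends ` (E - L))" for u
  proof -
    obtain e where "e \<in> E" "u \<in> proj ` f e"
      using u unfolding cends_def by blast
    then obtain w where w: "u = proj w" "w \<in> f e"
      by blast
    then have "w \<in> V"
      using endsE \<open>e \<in> E\<close> by blast
    then show ?thesis
      using c WV w(1) by (cases "w \<in> W") auto
  qed
  show connected': "(u, v) \<in> conn cends (E - L)"
    if "u \<in> \<Union>(cends ` (E - L))" "v \<in> \<Union>(cends ` (E - L))" for u v
    using conn_outer[of u v] verts[OF that(1)] verts[OF that(2)] by simp
  show "u \<noteq> v" if e: "e \<in> E - L" "cends e = {u, v}" for e u v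
  proof
    assume "u = v"
    obtain x y where xy: "f e = {x, y}"
      using fin_outer e(1) by (rule finite_edgesE)
    have "x \<noteq> y"
      using rank_connected_loopless[OF finE rank_connectedE assms(2) _ xy] e(1) by blast
    moreover have "proj x = proj y"
      using e(2) xy \<open>u = v\<close> unfolding cends_def by auto
    ultimately have "x \<in> W" "y \<in> W"
      using c unfolding proj_def by (metis (full_types))+
    then show False
      using e(1) xy induced by auto
  qed
  show "(u, v) \<in> conn cends {e \<in> E - L. x \<notin> cends e}"
    if uv: "u \<in> \<Union>(cends ` (E - L)) - {x}" "v \<in> \<Union>(cends ` (E - L)) - {x}" for x u v
  proof (cases "x = c")
    case True
    then show ?thesis
      using uv verts[of u] verts[of v] avoid unfolding True conn_avoiding by blast
  next
    case False
    have u: "u \<in> V" "proj u = u" "u \<noteq> x" and v: "v \<in> V" "proj v = v" "v \<noteq> x"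
      using uv verts[of u] verts[of v] by blast+
    \<comment> \<open>A path of \<open>G\<close> avoiding \<open>x\<close> projects to one avoiding
      \<open>x\<close>, since the only vertex that \<open>proj\<close> can introduce is
      \<open>c\<close>.\<close>
    have "(u, v) \<in> conn f {e \<in> E. x \<notin> f e}"
      using rank_connected_delete_vertex[OF finE rank_connectedE connectedE[OF u(1) v(1)]] u v
      by blast
    then have "(proj u, proj v) \<in> conn cends {e \<in> E - L. x \<notin> cends e}"
    proof (rule conn_hom)
      fix e p q assume e: "e \<in> {e \<in> E. x \<notin> f e}" "f e = {p, q}"
      show "(proj p, proj q) \<in> conn cends {e \<in> E - L. x \<notin> cends e}"
      proof (cases "e \<in> L")
        case True
        then have "p \<in> W" "q \<in> W"
          using e(2) ends by auto
        then show ?thesis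
          by (simp only: proj_inside conn_refl)
      next
        case False
        then have "e \<in> {e \<in> E - L. x \<notin> cends e}"
          using e(1) \<open>x \<noteq> c\<close> unfolding cends_def proj_def by auto
        then show ?thesis
          by (rule conn_edge) (simp add: cends_def e(2))
      qed
    qed
    then show ?thesis
      using u(2) v(2) by (simp only:)
  qed
qed

text \<open>With a second vertex to reach, no vertex of \<open>W\<close> is isolated in
  \<open>L\<close>. This yields the vertex condition of \<open>locked_subgraph\<close>.\<close>

lemma ends_L_eq:
  assumes "card W \<ge> 2"
  shows "\<Union>(f ` L) = W"
proof
  show "W \<subseteq> \<Union>(f ` L)"
  proof
    fix w assume w: "w \<in> W"
    have "\<not> W \<subseteq> {w}"
      using assms card_mono[of "{w}" W] by auto
    then obtain w' where "w' \<in> W" "w' \<noteq> w"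
      by blast
    then show "w \<in> \<Union>(f ` L)"
      using conn_isolated[OF connected[OF w, of w']] by metis
  qed
qed (rule ends)

text \<open>The core equivalence: the left side is the dual half of lockedness, with the dual rank
  bound written in cardinalities. Conditions on \<open>H\<close> alone, shared by both sides of the
  theorem, are left out.\<close>

lemma locked_iff:
  assumes "card W \<ge> 3"
  shows "rank_connected cends (E - L) \<and> card V + 2 \<le> card (E - L) + card W \<longleftrightarrow>
    L = {e \<in> E. f e \<subseteq> W} \<and> card W < card V \<and>
    (card (E - L) \<ge> card (\<Union>(f ` (E - L))) \<or> card (W \<inter> \<Union>(f ` (E - L))) \<ge> 3) \<and>
    (\<forall>u\<in>V - W. \<forall>v\<in>V - W. (u, v) \<in> conn f {e \<in> E. f e \<subseteq> V - W})"
    (is "?lhs \<longleftrightarrow> ?rhs")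
proof
  assume lhs: ?lhs
  have le: "card W \<le> card V"
    using WV finV by (rule card_mono[rotated])
  then have D: "card (E - L) \<ge> 2"
    using lhs by linarith
  have induced: "L = {e \<in> E. f e \<subseteq> W}"
    using lhs D by (intro rank_connected_outer_induced) blast+
  have "W \<noteq> V"
  proof
    assume "W = V"
    have "E - L = {}"
      using \<open>W = V\<close> induced endsE by blast
    then show False
      using D unfolding \<open>E - L = {}\<close> by simp
  qed
  then have "card W < card V"
    using WV finV by (intro psubset_card_mono) blast+
  \<comment> \<open>With at most two attachments, \<open>card_outer_verts\<close> turns the rank
    bound into the first alternative.\<close>
  moreover have "card (E - L) \<ge> card (\<Union>(f ` (E - L))) \<or> card (W \<inter> \<Union>(f ` (E - L))) \<ge> 3"
    using lhs card_outer_verts by linarith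
  ultimately show ?rhs
    using induced conn_avoiding_rank_connected lhs by blast
next
  assume rhs: ?rhs
  have "W \<noteq> {}"
    using c by blast
  then have "L \<noteq> {}"
    using ends_L_eq assms by force
  have VW: "card (V - W) + card W = card V" "V - W \<noteq> {}"
  proof -
    show "card (V - W) + card W = card V"
      using WV finV finW by (metis card_Diff_subset card_mono le_add_diff_inverse2)
    with rhs show "V - W \<noteq> {}"
      by force
  qed
  have K: "card (W \<inter> \<Union>(f ` (E - L))) \<ge> 2"
    using rhs \<open>L \<noteq> {}\<close> by (intro card_attachments_ge_2) blast+
  have "card (V - W) + card (W \<inter> \<Union>(f ` (E - L))) \<le> Suc (card (E - L))"
    using rhs VW(2) by (intro card_outer_ge_spanning) blast+
  \<comment> \<open>Under the first alternative of (ii), two attachments suffice by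
    \<open>card_outer_verts\<close>; under the second, three attachments suffice by the preceding
    edge bound.\<close>
  then have "card V + 2 \<le> card (E - L) + card W"
    using rhs K VW(1) card_outer_verts by linarith
  moreover have "rank_connected cends (E - L)"
    using rhs card_E_ge_2 \<open>L \<noteq> {}\<close> by (intro rank_connected_outerI) blast+
  ultimately show ?lhs
    by blast
qed

text \<open>Restricting the dual to \<open>E - L\<close> gives the dual of the contraction by
  \<open>L\<close>: the terms \<open>erank f L\<close> cancel.\<close>

lemma rk_dual:
  assumes M: "ground M = E" "\<forall>X\<subseteq>E. rk M X = erank f X" and Z: "Z \<subseteq> E - L"
  shows "rk (dual_matroid M) Z + erank cends (E - L) = card Z + erank cends (E - L - Z)"
proof -
  have fin: "finite_edges cends Z" "finite_edges cends (E - L - Z)" "finite_edges f (E - L - Z)"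
    using finite_edges_subset[OF fin_cends Z] finite_edges_subset[OF fin_cends Diff_subset]
      finite_edges_subset[OF fin_outer Diff_subset] .
  have sets: "(E - L - Z) \<union> L = E - Z" "(E - L - Z) \<union> Z = E - L"
    using LE Z by blast+
  have "rk M (E - Z) = erank cends (E - L - Z) + erank f L"
    using M(2)[rule_format, of "E - Z"] erank_cends[OF fin(3)] unfolding sets by simp
  moreover have "rk M E = erank cends (E - L) + erank f L"
    using M(2)[rule_format, of E] erank_cends[OF fin_outer] unfolding E_split by simp
  \<comment> \<open>Ensures that the subtraction in the dual rank does not truncate.\<close>
  moreover have "erank cends (E - L) \<le> erank cends (E - L - Z) + card Z"
    using erank_Un_le_card[OF fin(2,1)] unfolding sets .
  ultimately show ?thesis
    unfolding dual_matroid_def by (simp add: M(1))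
qed

text \<open>Duality preserves separations: cardinalities add over \<open>Z\<close> and its
  complement, so additivity of the dual rank and of the contraction rank say the same.\<close>

lemma two_connected_dual_iff:
  assumes M: "ground M = E" "\<forall>X\<subseteq>E. rk M X = erank f X"
  shows "two_connected_matroid (restrict_matroid (dual_matroid M) (E - L)) \<longleftrightarrow>
    rank_connected cends (E - L)"
proof -
  have "rk (dual_matroid M) (E - L) = rk (dual_matroid M) Z + rk (dual_matroid M) (E - L - Z) \<longleftrightarrow>
    erank cends (E - L) = erank cends Z + erank cends (E - L - Z)" if Z: "Z \<subset> E - L" for Z
  proof -
    have Z': "Z \<subseteq> E - L"
      using Z by (rule psubset_imp_subset)
    have sets: "E - L - (E - L) = {}" "E - L - (E - L - Z) = Z"
      using Z' by blast+
    have "card Z + card (E - L - Z) = card (E - L)"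
      using card_mono[OF finite_edgesD[OF fin_outer] Z'] Z'
        card_Diff_subset[OF finite_subset[OF Z' finite_edgesD[OF fin_outer]] Z']
      by linarith
    then show ?thesis
      using rk_dual[OF M order_refl] rk_dual[OF M Z'] rk_dual[OF M Diff_subset, of Z]
      unfolding sets by (simp only: erank_empty) linarith
  qed
  then show ?thesis
    unfolding two_connected_matroid_def disconnected_matroid_def rank_connected_def
      restrict_matroid_def by (simp only: matroid.simps) meson
qed

end

section \<open>Transfer to the graph and matroid records\<close>

lemma two_connected_restrict_iff:
  assumes "\<forall>X\<subseteq>E. rk M X = erank f X" "L \<subseteq> E"
  shows "two_connected_matroid (restrict_matroid M L) \<longleftrightarrow> rank_connected f L"
proof -
  have "rk M L = erank f L" "\<And>X. X \<subset> L \<Longrightarrow> rk M X = erank f X \<and> rk M (L - X) = erank f (L - X)"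
    using assms by (meson Diff_subset order_trans psubset_imp_subset)+
  then show ?thesis
    unfolding two_connected_matroid_def disconnected_matroid_def rank_connected_def
      restrict_matroid_def by (simp only: matroid.simps) (metis (no_types, lifting))
qed

lemma ground_graphic_matroid [simp]: "ground (graphic_matroid G) = edges G"
  by (simp add: graphic_matroid_def)

lemma two_connected_graphic_matroid_iff:
  assumes "finite_multigraph G" "connected_graph G"
  shows "two_connected_matroid (graphic_matroid G) \<longleftrightarrow> rank_connected (ends G) (edges G)"
proof -
  have "restrict_matroid (graphic_matroid G) (edges G) = graphic_matroid G"
    by (simp add: restrict_matroid_def graphic_matroid_def)
  then show ?thesis
    using two_connected_restrict_iff[of "edges G" "graphic_matroid G" "ends G" "edges G"]
      rk_graphic_matroid[OF assms]
    by simp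
qed

lemma finite_multigraph_induced_subgraph:
  "finite_multigraph G \<Longrightarrow> U \<subseteq> verts G \<Longrightarrow> finite_multigraph (induced_subgraph G U)"
  unfolding finite_multigraph_def induced_subgraph_def by (auto intro: finite_subset)

lemma eq_induced_subgraph_iff:
  fixes G H :: "('v, 'e) multigraph"
  assumes "ends H = ends G"
  shows "H = induced_subgraph G (verts H) \<longleftrightarrow> edges H = {e \<in> edges G. ends G e \<subseteq> verts H}"
  using assms by (cases H) (auto simp: induced_subgraph_def)

theorem theorem2p3:
  fixes G H :: "('v, 'e) multigraph"
  assumes "finite_multigraph G"
    and "two_connected_graph G"
    and "subgraph H G"
  shows "locked_subgraph G H \<longleftrightarrow>
    H = induced_subgraph G (verts H) \<and> two_connected_graph H \<and>
    (3 \<le> card (verts H) \<and> card (verts H) \<le> card (verts G) - 1) \<and>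
    (card (edges (complementary_subgraph G H)) \<ge> card (verts (complementary_subgraph G H)) \<or>
     card (verts H \<inter> verts (complementary_subgraph G H)) \<ge> 3) \<and>
    connected_graph (induced_subgraph G (verts G - verts H))"
proof -
  let ?M = "graphic_matroid G" and ?D = "edges G - edges H"
  have conG: "connected_graph G" and rankG: "two_connected_matroid ?M"
    using assms(2) by (simp_all add: two_connected_graph_def)
  have H: "verts H \<subseteq> verts G" "edges H \<subseteq> edges G" "ends H = ends G" "finite_multigraph H"
    using assms(3) by (simp_all add: subgraph_def)
  have rkM: "\<forall>X\<subseteq>edges G. rk ?M X = erank (ends G) X"
    using rk_graphic_matroid[OF assms(1) conG] by blast
  note restrict_iff = two_connected_restrict_iff[OF rkM H(2)]
  have finH: "finite_edges (ends G) (edges H)"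
    using finite_multigraph_finite_edges[OF H(4)] unfolding H(3) .
  have finV: "finite (verts G)"
    using assms(1) unfolding finite_multigraph_def by blast
  show ?thesis
  \<comment> \<open>For disconnected \<open>H\<close> both sides fail; otherwise \<open>H\<close>
    can be contracted to a vertex.\<close>
  proof (cases "connected_graph H")
    case False
    have "\<not> locked_subgraph G H"
    proof
      assume locked: "locked_subgraph G H"
      then have W: "verts H = \<Union>(ends G ` edges H)"
        and rank: "rank_connected (ends G) (edges H)" "rk ?M (edges H) \<ge> 2"
        unfolding locked_subgraph_def locked_subset_def restrict_iff incident_verts_def by simp_all
      have "erank (ends G) (edges H) \<noteq> 0"
        using rank(2) rkM[rule_format, OF H(2)] by simp
      \<comment> \<open>Positive rank forces an edge; an empty graph would not count as
        connected.\<close>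
      then have "verts H \<noteq> {}"
        unfolding W by (metis card.empty diff_0_eq_0 erank_def)
      moreover have "\<forall>u\<in>verts H. \<forall>v\<in>verts H. (u, v) \<in> conn (ends G) (edges H)"
        using rank_connected_conn[OF finH rank(1)] unfolding W by blast
      ultimately show False
        using False unfolding connected_graph_iff[OF H(4)] H(3) by blast
    qed
    then show ?thesis
      using False by (simp add: two_connected_graph_def)
  next
    case True
    then obtain c where c: "c \<in> verts H"
      and conH: "\<And>u v. u \<in> verts H \<Longrightarrow> v \<in> verts H \<Longrightarrow> (u, v) \<in> conn (ends G) (edges H)"
      unfolding connected_graph_iff[OF H(4)] H(3) by blast
    interpret contracted_graph "ends G" "edges H" "verts H" c "verts G" "edges G"
    proof
      show "\<Union>(ends G ` edges H) \<subseteq> verts H"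
        using finite_multigraph_ends[OF H(4) order_refl] unfolding H(3) .
      show "\<Union>(ends G ` edges G) \<subseteq> verts G"
        using assms(1) by (rule finite_multigraph_ends) simp
      show "finite_edges (ends G) (edges G)"
        using assms(1) by (rule finite_multigraph_finite_edges)
      show "rank_connected (ends G) (edges G)"
        using rankG two_connected_graphic_matroid_iff[OF assms(1) conG] by blast
      show "(u, v) \<in> conn (ends G) (edges G)" if "u \<in> verts G" "v \<in> verts G" for u v
        using conG that unfolding connected_graph_iff[OF assms(1)] by blast
    qed (use finH c conH finV H in blast)+
    have "rk (dual_matroid ?M) ?D + erank cends ?D = card ?D"
      using rk_dual[OF ground_graphic_matroid rkM order_refl] by simp
    \<comment> \<open>The dual rank of \<open>?D\<close> is its size minus the rank of
      \<open>G/H\<close>, which \<open>erank_outer\<close> computes.\<close>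
    then have dual_rank: "2 \<le> rk (dual_matroid ?M) ?D \<longleftrightarrow>
        card (verts G) + 2 \<le> card ?D + card (verts H)"
      using erank_outer by linarith
    have rank_L: "2 \<le> rk ?M (edges H) \<longleftrightarrow> 3 \<le> card (verts H)"
      using rkM[rule_format, OF H(2)] Suc_erank_L by linarith
    have "locked_subgraph G H \<longleftrightarrow> 3 \<le> card (verts H) \<and> rank_connected (ends G) (edges H) \<and>
        rank_connected cends ?D \<and> card (verts G) + 2 \<le> card ?D + card (verts H)"
    proof -
      have "3 \<le> card (verts H) \<Longrightarrow> verts H = incident_verts G (edges H)"
        using ends_L_eq unfolding incident_verts_def by simp
      then show ?thesis
        unfolding locked_subgraph_def locked_subset_def restrict_iff ground_graphic_matroid
          two_connected_dual_iff[OF ground_graphic_matroid rkM] min.bounded_iff dual_rank rank_L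
        using assms(3) rankG H(2) by blast
    qed
    moreover have "H = induced_subgraph G (verts H) \<longleftrightarrow>
        edges H = {e \<in> edges G. ends G e \<subseteq> verts H}"
      using H(3) by (rule eq_induced_subgraph_iff)
    moreover have "two_connected_graph H \<longleftrightarrow> rank_connected (ends G) (edges H)"
      using True two_connected_graphic_matroid_iff[OF H(4)] unfolding two_connected_graph_def H(3)
      by blast
    \<comment> \<open>\<open>Suc_erank_E\<close> makes \<open>card (verts G)\<close> positive, so
      the subtraction is exact.\<close>
    moreover have "card (verts H) \<le> card (verts G) - 1 \<longleftrightarrow> card (verts H) < card (verts G)"
      using Suc_erank_E by linarith
    moreover have "connected_graph (induced_subgraph G (verts G - verts H)) \<longleftrightarrow>
        verts G - verts H \<noteq> {} \<and> (\<forall>u\<in>verts G - verts H. \<forall>v\<in>verts G - verts H.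
          (u, v) \<in> conn (ends G) {e \<in> edges G. ends G e \<subseteq> verts G - verts H})"
      using connected_graph_iff[OF finite_multigraph_induced_subgraph[OF assms(1) Diff_subset]]
      unfolding induced_subgraph_def by simp
    \<comment> \<open>The nonemptiness that \<open>connected_graph\<close> demands in (iii) comes
      from the upper bound in (i).\<close>
    moreover have "verts G - verts H \<noteq> {}" if "card (verts H) < card (verts G)"
      using that H(1) by (metis Diff_eq_empty_iff nat_less_le subset_antisym)
    ultimately show ?thesis
      using locked_iff
      unfolding complementary_subgraph_def incident_verts_def multigraph.select_convs
      by blast
  qed
qed

end
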